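(* Let $\Sigma$ be a finite unranked alphabet, let $\mathcal{A}$ be an HA over $\Sigma$, and let $\mathcal{R}/\mathcal{A}$ be a PTRS parametrized by $\mathcal{A}$ belonging to the class $\mathsf{XACU}+$. Then for every HA language $L$, the set $\mathit{pre}^*_{\mathcal{R}/\mathcal{A}}(L)$ is an HA language.
   Context: Hedges and terms: fix a finite alphabet $\Sigma$ and an infinite set of variables $\mathcal{X}$. Hedges $\mathcal{H}(\Sigma,\mathcal{X})$ are finite (possibly empty, written $()$) sequences of terms, and terms are $\mathcal{T}(\Sigma,\mathcal{X}) = \mathcal{X}\cup\{a(h) : a\in\Sigma, h\in\mathcal{H}(\Sigma,\mathcal{X})\}$; terms are identified with hedges of length one. $\mathcal{H}(\Sigma)$, $\mathcal{T}(\Sigma)$ denote ground hedges/terms. A substitution maps finitely many variables to hedges and is applied homomorphically. A context is a hedge $u$ with one distinguished variable $x_u$ occurring exactly once; $u[h]$ is $u$ with $x_u$ replaced by $h$. Hedge automata: an HA is $\mathcal{A}=(\Sigma,Q,Q^{\mathsf f},\Delta)$ with $Q$ a finite set of states, $Q^{\mathsf f}\subseteq Q$ final states, and $\Delta$ a finite set of transitions $a(L)\to q$ with $a\in\Sigma$, $q\in Q$, $L\subseteq Q^*$ regular. Move relation: $u[a(q_1\dots q_n)]\to_{\mathcal{A}} u[q]$ whenever $a(L)\to q\in\Delta$ and $q_1\dots q_n\in L$. $L(\mathcal{A},q)=\{h\in\mathcal{H}(\Sigma): h\to^*_{\mathcal{A}} q\}$, $L(\mathcal{A})=\bigcup_{q\in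 Q^{\mathsf f}}L(\mathcal{A},q)$; HA languages are the sets $L(\mathcal{A})$. PTRS: given an HA $\mathcal{A}$ with state set $Q$, a PTRS $\mathcal{R}/\mathcal{A}$ is a finite set of rules $\ell\to r$, $\ell\in\mathcal{H}(\Sigma,\mathcal{X})$, $r\in\mathcal{H}(\Sigma\uplus Q,\mathcal{X})$ with states only at leaves of $r$. Its rewrite relation is that of the rule set obtained by replacing each state occurrence $q$ in $r$ by some ground hedge of $L(\mathcal{A},q)$: $h\to h'$ iff $h=u[\ell\sigma]$, $h'=u[r\sigma]$ for a context $u$, such an instantiated rule, and a substitution $\sigma$. $\mathit{pre}^*_{\mathcal{R}/\mathcal{A}}(L)=\{h : \exists h'\in L,\ h\to^* h'\}$. Class $\mathsf{XACU}+$: PTRS all of whose rules have one of the following forms (with $a,b\in\Sigma$, $p,p_1,\dots,p_n$ states of $\mathcal{A}$, $n\ge 0$, $x,y$ distinct variables): $a(x)\to b(x)$; $a(x)\to a(p\,x)$; $a(x)\to a(x\,p)$; $a(xy)\to a(x\,p\,y)$; $a(x)\to p\,a(x)$; $a(x)\to a(x)\,p$; $a(x)\to p$; $a(x)\to ()$; $a(x)\to b(p\,x)$; $a(x)\to b(x\,p)$; $a(x)\to p_1\dots p_n$; $a(x)\to x$.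
   Formalization: The result is proved for the set of ground terms (ground hedges of length one) in pre*(L), since HA languages contain only such hedges; literally the claim fails: with the rule a(x)→() and L={a()}, pre*(L) contains a()a(). *)

theory Defs
  imports Main "HOL-Library.Countable_Set"
begin

section \<open>Hedges, substitutions, contexts\<close>

datatype (syms: 'f, vars: 'v) tm = Var 'v | Node 'f "('f, 'v) tm list"
  for map: map_tm

type_synonym ('f, 'v) hedge = "('f, 'v) tm list"

definition ground :: "('f, 'v) hedge \<Rightarrow> bool" where
  "ground h \<longleftrightarrow> (\<forall>t \<in> set h. vars t = {})"

definition ground_terms :: "('f, 'v) hedge set" where
  "ground_terms = {h. ground h \<and> (\<exists>t. h = [t])}"

text \<open>Replacing a variable by a hedge turns a term into a hedge, which is spliced into the
  surrounding sequence.\<close>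

fun subst_tm :: "('v \<Rightarrow> ('f, 'v) hedge) \<Rightarrow> ('f, 'v) tm \<Rightarrow> ('f, 'v) hedge" where
  "subst_tm \<sigma> (Var x) = \<sigma> x"
| "subst_tm \<sigma> (Node f ts) = [Node f (concat (map (subst_tm \<sigma>) ts))]"

definition subst :: "('v \<Rightarrow> ('f, 'v) hedge) \<Rightarrow> ('f, 'v) hedge \<Rightarrow> ('f, 'v) hedge" where
  "subst \<sigma> h = concat (map (subst_tm \<sigma>) h)"

definition is_subst :: "('v \<Rightarrow> ('f, 'v) hedge) \<Rightarrow> bool" where
  "is_subst \<sigma> \<longleftrightarrow> finite {x. \<sigma> x \<noteq> [Var x]}"

fun occ_tm :: "'v \<Rightarrow> ('f, 'v) tm \<Rightarrow> nat" where
  "occ_tm x (Var y) = (if x = y then 1 else 0)"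
| "occ_tm x (Node f ts) = sum_list (map (occ_tm x) ts)"

definition occ :: "'v \<Rightarrow> ('f, 'v) hedge \<Rightarrow> nat" where
  "occ x h = sum_list (map (occ_tm x) h)"

text \<open>A context is a pair of its distinguished variable and a hedge.\<close>

type_synonym ('f, 'v) ctxt = "'v \<times> ('f, 'v) hedge"

definition is_ctxt :: "('f, 'v) ctxt \<Rightarrow> bool" where
  "is_ctxt u \<longleftrightarrow> occ (fst u) (snd u) = 1"

definition plug :: "('f, 'v) ctxt \<Rightarrow> ('f, 'v) hedge \<Rightarrow> ('f, 'v) hedge" where
  "plug u h = subst (\<lambda>y. if y = fst u then h else [Var y]) (snd u)"


section \<open>Regular word languages\<close>

text \<open>\<open>regular Q L\<close>: the set \<open>L\<close> of words over the alphabet \<open>Q\<close> is recognized by a complete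
  deterministic finite automaton, whose states are taken to be natural numbers.\<close>

definition regular :: "'q set \<Rightarrow> 'q list set \<Rightarrow> bool" where
  "regular Q L \<longleftrightarrow>
    (\<exists>(S :: nat set) s0 \<delta> F. finite S \<and> s0 \<in> S \<and> F \<subseteq> S \<and> (\<forall>s \<in> S. \<forall>q \<in> Q. \<delta> s q \<in> S) \<and>
      L = {w \<in> lists Q. foldl \<delta> s0 w \<in> F})"


section \<open>Hedge automata\<close>

text \<open>The alphabet is the (finite) type \<^typ>\<open>'a\<close>. Hedges mixing symbols and states have type
  \<^typ>\<open>('a + 'q, 'v) hedge\<close>; a state \<open>q\<close> occurring in a hedge is the leaf \<open>State q\<close>.\<close>

record ('a, 'q) ha =
  states :: "'q set"
  final :: "'q set"
  trans :: "('a \<times> 'q list set \<times> 'q) set"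

definition is_ha :: "('a, 'q) ha \<Rightarrow> bool" where
  "is_ha A \<longleftrightarrow> finite (states A) \<and> final A \<subseteq> states A \<and> finite (trans A) \<and>
    (\<forall>(a, L, q) \<in> trans A. q \<in> states A \<and> regular (states A) L)"

abbreviation Sym :: "'a \<Rightarrow> ('a + 'q, 'v) hedge \<Rightarrow> ('a + 'q, 'v) tm" where
  "Sym a h \<equiv> Node (Inl a) h"

abbreviation State :: "'q \<Rightarrow> ('a + 'q, 'v) tm" where
  "State q \<equiv> Node (Inr q) []"

definition embed :: "('a, 'v) hedge \<Rightarrow> ('a + 'q, 'v) hedge" where
  "embed h = map (map_tm Inl id) h"

inductive move :: "('a, 'q) ha \<Rightarrow> ('a + 'q, 'v) hedge \<Rightarrow> ('a + 'q, 'v) hedge \<Rightarrow> bool"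
  for A where
  "is_ctxt u \<Longrightarrow> (a, L, q) \<in> trans A \<Longrightarrow> w \<in> L \<Longrightarrow>
    move A (plug u [Sym a (map State w)]) (plug u [State q])"

definition ha_lang_state :: "('a, 'q) ha \<Rightarrow> 'q \<Rightarrow> ('a, 'v) hedge set" where
  "ha_lang_state A q = {h. ground h \<and> (move A)\<^sup>*\<^sup>* (embed h) [State q]}"

definition ha_lang :: "('a, 'q) ha \<Rightarrow> ('a, 'v) hedge set" where
  "ha_lang A = (\<Union>q \<in> final A. ha_lang_state A q)"

text \<open>State sets are finite, so it is no restriction to take the states to be natural numbers;
  see \<open>HA_language_ha_lang\<close> below.\<close>

definition HA_language :: "('a, 'v) hedge set \<Rightarrow> bool" where
  "HA_language L \<longleftrightarrow> (\<exists>A :: ('a, nat) ha. is_ha A \<and> L = ha_lang A)"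


section \<open>Parametrized rewriting\<close>

type_synonym ('a, 'q, 'v) prule = "('a, 'v) hedge \<times> ('a + 'q, 'v) hedge"

fun leaf_states :: "'q set \<Rightarrow> ('a + 'q, 'v) tm \<Rightarrow> bool" where
  "leaf_states Q (Var x) \<longleftrightarrow> True"
| "leaf_states Q (Node (Inl a) ts) \<longleftrightarrow> (\<forall>t \<in> set ts. leaf_states Q t)"
| "leaf_states Q (Node (Inr q) ts) \<longleftrightarrow> q \<in> Q \<and> ts = []"

definition is_ptrs :: "('a, 'q) ha \<Rightarrow> ('a, 'q, 'v) prule set \<Rightarrow> bool" where
  "is_ptrs A R \<longleftrightarrow> finite R \<and> (\<forall>(l, r) \<in> R. \<forall>t \<in> set r. leaf_states (states A) t)"

text \<open>\<open>inst_hedge A r r'\<close>: the hedge \<open>r'\<close> arises from \<open>r\<close> by replacing every occurrence of a state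
  \<open>q\<close>, independently, by some element of \<open>ha_lang_state A q\<close>.\<close>

inductive
  inst_tm :: "('a, 'q) ha \<Rightarrow> ('a + 'q, 'v) tm \<Rightarrow> ('a, 'v) hedge \<Rightarrow> bool" and
  inst_hedge :: "('a, 'q) ha \<Rightarrow> ('a + 'q, 'v) hedge \<Rightarrow> ('a, 'v) hedge \<Rightarrow> bool"
  for A where
  "inst_tm A (Var x) [Var x]"
| "h \<in> ha_lang_state A q \<Longrightarrow> inst_tm A (State q) h"
| "inst_hedge A ts h \<Longrightarrow> inst_tm A (Sym a ts) [Node a h]"
| "inst_hedge A [] []"
| "inst_tm A t h \<Longrightarrow> inst_hedge A ts h' \<Longrightarrow> inst_hedge A (t # ts) (h @ h')"

inductive rewrite ::
  "('a, 'q) ha \<Rightarrow> ('a, 'q, 'v) prule set \<Rightarrow> ('a, 'v) hedge \<Rightarrow> ('a, 'v) hedge \<Rightarrow> bool"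
  for A R where
  "(l, r) \<in> R \<Longrightarrow> inst_hedge A r r' \<Longrightarrow> is_ctxt u \<Longrightarrow> is_subst \<sigma> \<Longrightarrow>
    rewrite A R (plug u (subst \<sigma> l)) (plug u (subst \<sigma> r'))"

definition pre_star ::
  "('a, 'q) ha \<Rightarrow> ('a, 'q, 'v) prule set \<Rightarrow> ('a, 'v) hedge set \<Rightarrow> ('a, 'v) hedge set" where
  "pre_star A R L = {h. \<exists>h' \<in> L. (rewrite A R)\<^sup>*\<^sup>* h h'}"

inductive xacu_plus_rule :: "('a, 'q) ha \<Rightarrow> ('a, 'q, 'v) prule \<Rightarrow> bool" for A where
  "xacu_plus_rule A ([Node a [Var x]], [Sym b [Var x]])"
| "p \<in> states A \<Longrightarrow> xacu_plus_rule A ([Node a [Var x]], [Sym a [State p, Var x]])"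
| "p \<in> states A \<Longrightarrow> xacu_plus_rule A ([Node a [Var x]], [Sym a [Var x, State p]])"
| "p \<in> states A \<Longrightarrow> x \<noteq> y \<Longrightarrow>
    xacu_plus_rule A ([Node a [Var x, Var y]], [Sym a [Var x, State p, Var y]])"
| "p \<in> states A \<Longrightarrow> xacu_plus_rule A ([Node a [Var x]], [State p, Sym a [Var x]])"
| "p \<in> states A \<Longrightarrow> xacu_plus_rule A ([Node a [Var x]], [Sym a [Var x], State p])"
| "p \<in> states A \<Longrightarrow> xacu_plus_rule A ([Node a [Var x]], [State p])"
| "xacu_plus_rule A ([Node a [Var x]], [])"
| "p \<in> states A \<Longrightarrow> xacu_plus_rule A ([Node a [Var x]], [Sym b [State p, Var x]])"
| "p \<in> states A \<Longrightarrow> xacu_plus_rule A ([Node a [Var x]], [Sym b [Var x, State p]])"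
| "set ps \<subseteq> states A \<Longrightarrow> xacu_plus_rule A ([Node a [Var x]], map State ps)"
| "xacu_plus_rule A ([Node a [Var x]], [Var x])"

definition xacu_plus :: "('a, 'q) ha \<Rightarrow> ('a, 'q, 'v) prule set \<Rightarrow> bool" where
  "xacu_plus A R \<longleftrightarrow> (\<forall>\<rho> \<in> R. xacu_plus_rule A \<rho>)"


section \<open>Independence of the type of states\<close>

definition map_ha :: "('q \<Rightarrow> 'r) \<Rightarrow> ('a, 'q) ha \<Rightarrow> ('a, 'r) ha" where
  "map_ha f A = \<lparr>states = f ` states A, final = f ` final A,
     trans = (\<lambda>(a, L, q). (a, map f ` L, f q)) ` trans A\<rparr>"

lemma map_subst_tm:
  "map (map_tm g id) (subst_tm \<sigma> t) = subst_tm (\<lambda>x. map (map_tm g id) (\<sigma> x)) (map_tm g id t)"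
  by (induction t) (auto simp: map_concat comp_def intro!: arg_cong[where f = concat])

lemma map_plug:
  "map (map_tm g id) (plug (x, u) h) = plug (x, map (map_tm g id) u) (map (map_tm g id) h)"
  by (simp add: plug_def subst_def map_concat comp_def map_subst_tm if_distrib cong: if_cong)

lemma occ_map_tm: "occ_tm x (map_tm g id t) = occ_tm x t"
  by (induction t) (auto simp: comp_def intro!: arg_cong[where f = sum_list])

lemma is_ctxt_map: "is_ctxt (x, map (map_tm g id) u) \<longleftrightarrow> is_ctxt (x, u)"
  by (simp add: is_ctxt_def occ_def comp_def occ_map_tm)

lemma move_map:
  assumes "move A g g'"
  shows "move (map_ha f A) (map (map_tm (map_sum id f) id) g) (map (map_tm (map_sum id f) id) g')"
  using assms
proof cases
  case (1 u a L q w)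
  obtain x v where u: "u = (x, v)" by (cases u)
  let ?u = "(x, map (map_tm (map_sum id f) id) v)"
  have "move (map_ha f A) (plug ?u [Sym a (map State (map f w))]) (plug ?u [State (f q)])"
    using 1 u by (intro move.intros[where L = "map f ` L"])
      (auto simp: map_ha_def is_ctxt_map intro!: rev_image_eqI)
  then show ?thesis using 1 u by (simp add: map_plug comp_def)
qed

lemma moves_map:
  assumes "(move A)\<^sup>*\<^sup>* g g'"
  shows "(move (map_ha f A))\<^sup>*\<^sup>*
    (map (map_tm (map_sum id f) id) g) (map (map_tm (map_sum id f) id) g')"
  using assms by induction (blast intro: move_map rtranclp.rtrancl_into_rtrancl)+

lemma map_embed: "map (map_tm (map_sum id f) id) (embed h) = embed h"
  by (simp add: embed_def tm.map_comp comp_def id_def)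

lemma ha_lang_state_map: "ha_lang_state A q \<subseteq> ha_lang_state (map_ha f A) (f q)"
  using moves_map[of A _ "[State q]" f] by (force simp: ha_lang_state_def map_embed)

lemma regular_map:
  assumes "regular Q L" "inj_on f Q"
  shows "regular (f ` Q) (map f ` L)"
proof -
  let ?g = "inv_into Q f"
  from assms(1) obtain S :: "nat set" and s0 \<delta> F where D:
    "finite S" "s0 \<in> S" "F \<subseteq> S" "\<forall>s \<in> S. \<forall>q \<in> Q. \<delta> s q \<in> S"
    "L = {w \<in> lists Q. foldl \<delta> s0 w \<in> F}"
    unfolding regular_def by blast
  have fold: "foldl (\<lambda>s q. \<delta> s (?g q)) s (map f w) = foldl \<delta> s w" if "w \<in> lists Q" for s w
    using that assms(2) by (induction w arbitrary: s) auto
  have "map f ` L = {w \<in> lists (f ` Q). foldl (\<lambda>s q. \<delta> s (?g q)) s0 w \<in> F}"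
  proof (intro set_eqI iffI)
    fix v assume "v \<in> map f ` L"
    then obtain w where "v = map f w" "w \<in> lists Q" "foldl \<delta> s0 w \<in> F" using D(5) by blast
    then show "v \<in> {w \<in> lists (f ` Q). foldl (\<lambda>s q. \<delta> s (?g q)) s0 w \<in> F}"
      using fold[of w s0] by auto
  next
    fix v assume "v \<in> {w \<in> lists (f ` Q). foldl (\<lambda>s q. \<delta> s (?g q)) s0 w \<in> F}"
    then obtain w where "v = map f w" "w \<in> lists Q" "foldl (\<lambda>s q. \<delta> s (?g q)) s0 v \<in> F"
      unfolding lists_image by blast
    then show "v \<in> map f ` L" using fold[of w s0] D(5) by auto
  qed
  then show ?thesis
    unfolding regular_def using D assms(2)
    by (intro exI[of _ S] exI[of _ s0] exI[of _ "\<lambda>s q. \<delta> s (?g q)"] exI[of _ F]) auto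
qed

lemma map_ha_inverse:
  assumes "is_ha A" "\<And>q. q \<in> states A \<Longrightarrow> g (f q) = q"
  shows "map_ha g (map_ha f A) = A"
proof -
  have Lid: "map g ` map f ` L = L" if "(a, L, q) \<in> trans A" for a L q
  proof -
    have "L \<subseteq> lists (states A)" using that assms(1) by (auto simp: is_ha_def regular_def)
    then have "map g (map f w) = w" if "w \<in> L" for w
      using that assms(2) by (auto intro!: map_idI)
    then show ?thesis by (force simp: image_image)
  qed
  have "g ` f ` states A = states A" using assms(2) by (force simp: image_image)
  moreover have "g ` f ` final A = final A"
    using assms by (force simp: is_ha_def image_image)
  moreover have "(\<lambda>(a, L, q). (a, map g ` L, g q)) ` (\<lambda>(a, L, q). (a, map f ` L, f q)) ` trans A
      = (\<lambda>\<tau>. \<tau>) ` trans A"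
    unfolding image_image using assms Lid
    by (intro image_cong refl) (clarsimp simp: is_ha_def Lid simp del: map_map, blast)
  ultimately show ?thesis by (simp add: map_ha_def)
qed

lemma HA_language_ha_lang:
  fixes A :: "('a, 'q) ha"
  assumes "is_ha A"
  shows "HA_language (ha_lang A :: ('a, 'v) hedge set)"
proof -
  obtain f :: "'q \<Rightarrow> nat" where f: "inj_on f (states A)"
    using assms by (meson is_ha_def countable_finite countableE)
  define g where "g = inv_into (states A) f"
  have gf: "g (f q) = q" if "q \<in> states A" for q using f that by (simp add: g_def)
  have "is_ha (map_ha f A)"
    using assms regular_map[OF _ f] by (auto simp: is_ha_def map_ha_def)
  moreover have "(ha_lang_state (map_ha f A) (f q) :: ('a, 'v) hedge set) = ha_lang_state A q"
    if "q \<in> states A" for q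
    using ha_lang_state_map[of A q f] ha_lang_state_map[of "map_ha f A" "f q" g]
      map_ha_inverse[where f = f and g = g, OF assms gf] gf[OF that] by auto
  then have "(ha_lang A :: ('a, 'v) hedge set) = ha_lang (map_ha f A)"
    using assms by (auto simp: ha_lang_def map_ha_def is_ha_def)
  ultimately show ?thesis unfolding HA_language_def by blast
qed

end

theory Submission imports Defs begin

text \<open>No automaton for the closure is constructed. Instead, \<open>pre*(L)\<close> is saturated by a congruence of
  finite index on hedges, compatible with concatenation and with \<open>h \<mapsto> a(h)\<close>, and such a congruence
  is turned into a hedge automaton as in the Myhill-Nerode theorem.

  Let \<open>S\<close> be the finite set of residuals of the horizontal languages of an automaton for \<open>L\<close>; every
  hedge acts on \<open>S\<close> as a relation. For a relation \<open>\<rho>\<close> on \<open>S\<close>, let \<open>reach \<rho> h\<close> be the union, over all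
  \<open>t\<^sub>1 \<dots> t\<^sub>n\<close> reachable from \<open>h\<close>, of the relations \<open>\<rho> t\<^sub>1 \<rho> t\<^sub>2 \<dots> \<rho> t\<^sub>n\<close>. Two hedges are congruent if they
  have the same \<open>reach \<rho>\<close> for every \<open>\<rho>\<close>. The key point is compatibility with \<open>h \<mapsto> a(h)\<close>: in a
  derivation from \<open>a(h)\<close> the steps on \<open>h\<close> can be done first, and what the rules applied at the root
  then do to the reached hedge \<open>w\<close> is to fill its gaps with hedges from a set \<open>E\<close> that works
  uniformly for all \<open>w\<close>. As far as \<open>S\<close> is concerned, only the relation \<open>\<rho>\<close> induced by \<open>E\<close>
  matters.\<close>

section \<open>Rewriting with single-term left-hand sides\<close>

text \<open>The rule shapes reduce to four kinds: \<open>W\<close> relabels the root and adds hedges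
  beside it or at the ends of its content, \<open>I\<close> inserts into any gap, \<open>P\<close>
  discards the content, \<open>C\<close> strips the root. The sets hold instances with states
  already replaced by hedges, so they may be infinite.\<close>

locale hedge_system =
  fixes W :: "('a \<times> ('a, 'v) hedge \<times> ('a, 'v) hedge \<times> ('a, 'v) hedge \<times> ('a, 'v) hedge \<times> 'a) set"
    and I :: "('a \<times> ('a, 'v) hedge) set"
    and P :: "('a \<times> ('a, 'v) hedge) set"
    and C :: "'a set"
begin

inductive tstep :: "('a, 'v) tm \<Rightarrow> ('a, 'v) hedge \<Rightarrow> bool" where
  wrap: "(a, l, u, v, r, b) \<in> W \<Longrightarrow> tstep (Node a m) (l @ [Node b (u @ m @ v)] @ r)"
| ins: "(a, u) \<in> I \<Longrightarrow> tstep (Node a (m @ m')) [Node a (m @ u @ m')]"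
| repl: "(a, u) \<in> P \<Longrightarrow> tstep (Node a m) u"
| collapse: "a \<in> C \<Longrightarrow> tstep (Node a m) m"
| inner: "tstep t k \<Longrightarrow> tstep (Node a (g @ t # g')) [Node a (g @ k @ g')]"

definition hstep :: "('a, 'v) hedge \<Rightarrow> ('a, 'v) hedge \<Rightarrow> bool" where
  "hstep h h' \<longleftrightarrow> (\<exists>g t g' k. h = g @ t # g' \<and> h' = g @ k @ g' \<and> tstep t k)"

abbreviation hsteps :: "('a, 'v) hedge \<Rightarrow> ('a, 'v) hedge \<Rightarrow> bool" where
  "hsteps \<equiv> hstep\<^sup>*\<^sup>*"

lemma hstep_tstep: "tstep t k \<Longrightarrow> hstep [t] k"
  unfolding hstep_def by (metis append_Nil append_Nil2)

lemma hstep_singletonD: "hstep [t] k \<Longrightarrow> tstep t k"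
  unfolding hstep_def by (auto simp: Cons_eq_append_conv)

lemma hstep_Nil [simp]: "\<not> hstep [] h"
  by (simp add: hstep_def)

lemma hstep_context: "hstep h h' \<Longrightarrow> hstep (g @ h @ g') (g @ h' @ g')"
  unfolding hstep_def by (metis append.assoc append_Cons)

lemma hstep_Node: "hstep h h' \<Longrightarrow> hstep [Node a h] [Node a h']"
  unfolding hstep_def[of h] by (auto intro: hstep_tstep inner)

lemma tstep_NodeE:
  assumes "tstep (Node a m) k"
  obtains (wrap) l u v r b where "(a, l, u, v, r, b) \<in> W" "k = l @ [Node b (u @ m @ v)] @ r"
  | (ins) u m1 m2 where "(a, u) \<in> I" "m = m1 @ m2" "k = [Node a (m1 @ u @ m2)]"
  | (repl) "(a, k) \<in> P"
  | (collapse) "a \<in> C" "k = m"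
  | (inner) m' where "hstep m m'" "k = [Node a m']"
  using assms
proof cases
  case (inner t k g g')
  then show thesis using that(5) hstep_def by blast
qed (auto intro: that)

lemma hstep_appendE:
  assumes "hstep (h1 @ h2) h"
  obtains h1' where "hstep h1 h1'" "h = h1' @ h2" | h2' where "hstep h2 h2'" "h = h1 @ h2'"
proof -
  obtain g t g' k where *: "h1 @ h2 = g @ t # g'" "h = g @ k @ g'" "tstep t k"
    using assms by (auto simp: hstep_def)
  then consider z where "h1 = g @ t # z" "g' = z @ h2" | z where "h2 = z @ t # g'" "g = h1 @ z"
    by (auto simp: append_eq_append_conv2 append_eq_Cons_conv)
  then show thesis
  proof cases
    case 1
    then have "hstep h1 (g @ k @ z)" using * hstep_def by blast
    then show thesis using that(1) * 1 by simp
  next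
    case 2
    then have "hstep h2 (z @ k @ g')" using * hstep_def by blast
    then show thesis using that(2) * 2 by simp
  qed
qed

lemma hsteps_context: "hsteps h h' \<Longrightarrow> hsteps (g @ h @ g') (g @ h' @ g')"
  by (induction rule: rtranclp_induct) (auto intro: hstep_context rtranclp.rtrancl_into_rtrancl)

lemma hsteps_Node: "hsteps h h' \<Longrightarrow> hsteps [Node a h] [Node a h']"
  by (induction rule: rtranclp_induct) (auto intro: hstep_Node rtranclp.rtrancl_into_rtrancl)

lemma hsteps_append:
  assumes "hsteps h1 h1'" "hsteps h2 h2'"
  shows "hsteps (h1 @ h2) (h1' @ h2')"
  using hsteps_context[OF assms(1), of "[]" h2] hsteps_context[OF assms(2), of h1' "[]"] by simp

text \<open>A step rewrites one term, so it never straddles the border of two neighbouring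
  hedges.\<close>

lemma hsteps_appendE:
  assumes "hsteps (h1 @ h2) h"
  obtains h1' h2' where "hsteps h1 h1'" "hsteps h2 h2'" "h = h1' @ h2'"
proof -
  have "\<exists>h1' h2'. hsteps h1 h1' \<and> hsteps h2 h2' \<and> h = h1' @ h2'"
    using assms
  proof (induction rule: rtranclp_induct)
    case (step y z)
    then obtain h1' h2' where *: "hsteps h1 h1'" "hsteps h2 h2'" "hstep (h1' @ h2') z" by blast
    from *(3) show ?case
      by (cases rule: hstep_appendE) (use *(1,2) in \<open>blast intro: rtranclp.rtrancl_into_rtrancl\<close>)+
  qed blast
  then show thesis using that by blast
qed

text \<open>The evolution of the root of \<open>a(w)\<close> into \<open>l b(m) r\<close>. Steps below the root and steps inside
  the inserted hedges can be moved to the front, so \<open>w\<close> stays untouched and every hedge is inserted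
  in its final form.\<close>

inductive root_evol :: "'a \<Rightarrow> ('a, 'v) hedge \<Rightarrow> ('a, 'v) hedge \<Rightarrow> 'a \<Rightarrow> ('a, 'v) hedge \<Rightarrow>
    ('a, 'v) hedge \<Rightarrow> bool" for a where
  refl: "root_evol a w [] a w []"
| wrap: "root_evol a w l b m r \<Longrightarrow> (b, l1, u1, v1, r1, c) \<in> W \<Longrightarrow>
    hsteps l1 l' \<Longrightarrow> hsteps u1 u \<Longrightarrow> hsteps v1 v \<Longrightarrow> hsteps r1 r' \<Longrightarrow>
    root_evol a w (l @ l') c (u @ m @ v) (r' @ r)"
| ins: "root_evol a w l b (m @ m') r \<Longrightarrow> (b, u1) \<in> I \<Longrightarrow> hsteps u1 u \<Longrightarrow>
    root_evol a w l b (m @ u @ m') r"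

lemma root_evol_hsteps:
  "root_evol a w l b m r \<Longrightarrow> hsteps [Node a w] (l @ [Node b m] @ r)"
proof (induction rule: root_evol.induct)
  case (wrap w l b m r l1 u1 v1 r1 c l' u v r')
  have "hstep (l @ [Node b m] @ r) (l @ (l1 @ [Node c (u1 @ m @ v1)] @ r1) @ r)"
    using wrap.hyps(2) by (intro hstep_context hstep_tstep tstep.wrap)
  moreover have "hsteps [Node c (u1 @ m @ v1)] [Node c (u @ m @ v)]"
    by (intro hsteps_Node hsteps_append wrap.hyps rtranclp.rtrancl_refl)
  then have "hsteps (l @ (l1 @ [Node c (u1 @ m @ v1)] @ r1) @ r)
      (l @ (l' @ [Node c (u @ m @ v)] @ r') @ r)"
    by (intro hsteps_append wrap.hyps rtranclp.rtrancl_refl)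
  ultimately have "hsteps (l @ [Node b m] @ r) (l @ (l' @ [Node c (u @ m @ v)] @ r') @ r)"
    by (rule converse_rtranclp_into_rtranclp)
  from rtranclp_trans[OF wrap.IH this] show ?case by simp
next
  case (ins w l b m m' r u1 u)
  have "hstep (l @ [Node b (m @ m')] @ r) (l @ [Node b (m @ u1 @ m')] @ r)"
    using ins.hyps(2) by (intro hstep_context hstep_tstep tstep.ins)
  moreover have "hsteps (l @ [Node b (m @ u1 @ m')] @ r) (l @ [Node b (m @ u @ m')] @ r)"
    by (intro hsteps_append hsteps_Node ins.hyps rtranclp.rtrancl_refl)
  ultimately have "hsteps (l @ [Node b (m @ m')] @ r) (l @ [Node b (m @ u @ m')] @ r)"
    by (rule converse_rtranclp_into_rtranclp)
  with ins.IH show ?case by (rule rtranclp_trans)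
qed simp

text \<open>\<open>l\<close> is a concatenation of pieces, each carrying its own derivation from a
  rule instance; a step falls into one piece and prolongs that derivation.\<close>

lemma root_evol_step_left:
  "root_evol a w l b m r \<Longrightarrow> hstep l k \<Longrightarrow> root_evol a w k b m r"
proof (induction arbitrary: k rule: root_evol.induct)
  case (wrap w l b m r l1 u1 v1 r1 c l' u v r')
  from wrap.prems show ?case
  proof (cases rule: hstep_appendE)
    case (1 h)
    then show ?thesis using wrap by (auto intro!: root_evol.wrap)
  next
    case (2 h)
    then show ?thesis
      using root_evol.wrap[OF wrap.hyps(1,2) rtranclp.rtrancl_into_rtrancl wrap.hyps(4-6)]
        wrap.hyps(3) by simp
  qed
qed (auto intro: root_evol.ins)

lemma root_evol_step_right:
  "root_evol a w l b m r \<Longrightarrow> hstep r k \<Longrightarrow> root_evol a w l b m k"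
proof (induction arbitrary: k rule: root_evol.induct)
  case (wrap w l b m r l1 u1 v1 r1 c l' u v r')
  from wrap.prems show ?case
  proof (cases rule: hstep_appendE)
    case (1 h)
    then have "hsteps r1 h" using wrap.hyps by (meson rtranclp.rtrancl_into_rtrancl)
    then show ?thesis using 1 wrap by (auto intro!: root_evol.wrap)
  next
    case (2 h)
    then show ?thesis using wrap by (auto intro!: root_evol.wrap)
  qed
qed (auto intro: root_evol.ins)

text \<open>Steps in inserted pieces prolong their derivations; all others act on material of
  \<open>w\<close> and commute with the root steps, so they are performed first.\<close>

lemma root_evol_step_inner:
  "root_evol a w l b m r \<Longrightarrow> hstep m k \<Longrightarrow> \<exists>w'. hsteps w w' \<and> root_evol a w' l b k r"
proof (induction arbitrary: k rule: root_evol.induct)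
  case (refl w)
  then show ?case by (blast intro: root_evol.refl)
next
  case (wrap w l b m r l1 u1 v1 r1 c l' u v r')
  from wrap.prems show ?case
  proof (cases rule: hstep_appendE)
    case (1 h)
    then have "hsteps u1 h" using wrap.hyps by (meson rtranclp.rtrancl_into_rtrancl)
    then show ?thesis using 1 wrap.hyps by (auto intro!: root_evol.wrap)
  next
    case outer: (2 h)
    from outer(1) show ?thesis
    proof (cases rule: hstep_appendE)
      case (1 h')
      then show ?thesis using outer wrap.IH wrap.hyps by (blast intro: root_evol.wrap)
    next
      case (2 h')
      then have "hsteps v1 h'" using wrap.hyps by (meson rtranclp.rtrancl_into_rtrancl)
      then show ?thesis using 2 outer wrap.hyps by (auto intro!: root_evol.wrap)
    qed
  qed
next
  case (ins w l b m m' r u1 u)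
  \<comment> \<open>A step beside the inserted \<open>u\<close> is a step on \<open>m @ m'\<close>
    that keeps the gap, so \<open>u\<close> can be inserted there afterwards.\<close>
  have *: ?case if "hstep (m @ m') (n @ n')" "k = n @ u @ n'" for n n'
    using that ins by (blast intro: root_evol.ins)
  from ins.prems show ?case
  proof (cases rule: hstep_appendE)
    case (1 h)
    then show ?thesis using * hstep_context[of m h "[]" m'] by simp
  next
    case outer: (2 h)
    from outer(1) show ?thesis
    proof (cases rule: hstep_appendE)
      case (1 h')
      then have "hsteps u1 h'" using ins.hyps by (meson rtranclp.rtrancl_into_rtrancl)
      then show ?thesis using 1 outer ins.hyps by (auto intro!: root_evol.ins)
    next
      case (2 h')
      then show ?thesis using outer * hstep_context[of m' h' m "[]"] by simp
    qed
  qed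
qed

text \<open>The node evolving from the root survives or is removed once, by a collapse or a
  replacement. After a removal only hedges already accounted for remain to be rewritten.\<close>

inductive result :: "'a \<Rightarrow> ('a, 'v) hedge \<Rightarrow> ('a, 'v) hedge \<Rightarrow> bool" for a w where
  stay: "root_evol a w l b m r \<Longrightarrow> result a w (l @ [Node b m] @ r)"
| collapse: "root_evol a w l b m r \<Longrightarrow> b \<in> C \<Longrightarrow> result a w (l @ m @ r)"
| repl: "root_evol a w l b m r \<Longrightarrow> (b, u1) \<in> P \<Longrightarrow> hsteps u1 u \<Longrightarrow> result a w (l @ u @ r)"

lemma result_hsteps:
  assumes "result a w h" shows "hsteps [Node a w] h"
  using assms
proof cases
  case (stay l b m r)
  then show ?thesis using root_evol_hsteps by blast
next
  case (collapse l b m r)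
  then have "hstep (l @ [Node b m] @ r) (l @ m @ r)"
    by (intro hstep_context hstep_tstep tstep.collapse)
  with root_evol_hsteps[OF collapse(2)] show ?thesis
    unfolding collapse(1) by (rule rtranclp.rtrancl_into_rtrancl)
next
  case (repl l b m r u1 u)
  then have "hstep (l @ [Node b m] @ r) (l @ u1 @ r)"
    by (intro hstep_context hstep_tstep tstep.repl)
  with root_evol_hsteps[OF repl(2)] have "hsteps [Node a w] (l @ u1 @ r)"
    by (rule rtranclp.rtrancl_into_rtrancl)
  then show ?thesis
    using hsteps_context[OF repl(4)] unfolding repl(1) by (rule rtranclp_trans)
qed

text \<open>A step on the surviving root extends or ends its evolution; any other step is absorbed
  by a derivation of an inserted hedge or moved to the front, into \<open>w\<close>.\<close>

lemma result_step:
  assumes "result a w h" "hstep h h'"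
  shows "\<exists>w'. hsteps w w' \<and> result a w' h'"
  using assms(1)
proof cases
  case (stay l b m r)
  from assms(2)[unfolded stay(1)] show ?thesis
  proof (cases rule: hstep_appendE)
    case (1 l')
    then show ?thesis using stay root_evol_step_left result.stay by blast
  next
    case outer: (2 k)
    from outer(1) show ?thesis
    proof (cases rule: hstep_appendE)
      case (1 k')
      then have "tstep (Node b m) k'" by (intro hstep_singletonD)
      then show ?thesis
      proof (cases rule: tstep_NodeE)
        case (wrap l1 u v r1 c)
        then have "root_evol a w (l @ l1) c (u @ m @ v) (r1 @ r)"
          using stay by (blast intro: root_evol.wrap)
        from result.stay[OF this] show ?thesis using 1 outer wrap by auto
      next
        case (ins u m1 m2)
        then have "root_evol a w l b (m1 @ u @ m2) r"
          using stay by (blast intro: root_evol.ins)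
        from result.stay[OF this] show ?thesis using 1 outer ins by auto
      next
        case repl
        then show ?thesis using 1 outer stay result.repl by blast
      next
        case collapse
        then show ?thesis using 1 outer stay result.collapse by blast
      next
        case (inner m')
        then show ?thesis using 1 outer stay root_evol_step_inner result.stay by blast
      qed
    next
      case (2 r')
      then show ?thesis using outer stay root_evol_step_right result.stay by blast
    qed
  qed
next
  case (collapse l b m r)
  from assms(2)[unfolded collapse(1)] show ?thesis
  proof (cases rule: hstep_appendE)
    case (1 l')
    then show ?thesis using collapse root_evol_step_left result.collapse by blast
  next
    case outer: (2 k)
    from outer(1) show ?thesis
    proof (cases rule: hstep_appendE)
      case (1 m')
      then show ?thesis using outer collapse root_evol_step_inner result.collapse by blast
    next
      case (2 r')
      then show ?thesis using outer collapse root_evol_step_right result.collapse by blast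
    qed
  qed
next
  case (repl l b m r u1 u)
  from assms(2)[unfolded repl(1)] show ?thesis
  proof (cases rule: hstep_appendE)
    case (1 l')
    then show ?thesis using repl root_evol_step_left result.repl by blast
  next
    case outer: (2 k)
    from outer(1) show ?thesis
    proof (cases rule: hstep_appendE)
      case (1 u')
      then have "hsteps u1 u'" using repl by (meson rtranclp.rtrancl_into_rtrancl)
      then show ?thesis using 1 outer repl result.repl by blast
    next
      case (2 r')
      then show ?thesis using outer repl root_evol_step_right result.repl by blast
    qed
  qed
qed

lemma hsteps_Node_result:
  assumes "hsteps [Node a w] h"
  shows "\<exists>w'. hsteps w w' \<and> result a w' h"
  using assms
proof (induction rule: rtranclp_induct)
  case base
  show ?case using result.stay[OF root_evol.refl] by auto
next
  case (step y z)
  then obtain w1 w2 where "hsteps w w1" "hsteps w1 w2" "result a w2 z" using result_step by blast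
  then show ?case by (meson rtranclp_trans)
qed

section \<open>Uniformity of the evolution of the root\<close>

text \<open>Elements of \<open>E\<close> are put in front of every term, but not behind the last one: this makes
  \<open>gap_rel\<close> below multiplicative.\<close>

primrec pad :: "('a, 'v) hedge set \<Rightarrow> ('a, 'v) hedge \<Rightarrow> ('a, 'v) hedge set" where
  "pad E [] = {[]}"
| "pad E (t # w) = {e @ t # k | e k. e \<in> E \<and> k \<in> pad E w}"

lemma pad_mono: "E \<subseteq> E' \<Longrightarrow> pad E w \<subseteq> pad E' w"
  by (induction w) fastforce+

lemma pad_singleton_Nil [simp]: "pad {[]} w = {w}"
  by (induction w) auto

text \<open>The insertion point lies in the filling before some term, its ends included, since
  \<open>y \<noteq> []\<close> excludes the end of the hedge. \<open>E'\<close> has that filling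
  with \<open>u\<close> inserted anywhere.\<close>

lemma pad_insert:
  assumes "x @ y \<in> pad E w" "y \<noteq> []" "E' = E \<union> {e1 @ u @ e2 | e1 e2. e1 @ e2 \<in> E}"
  shows "x @ u @ y \<in> pad E' w"
  using assms(1)
proof (induction w arbitrary: x)
  case Nil
  then show ?case using assms(2) by simp
next
  case (Cons t w)
  then obtain e k where ek: "x @ y = e @ t # k" "e \<in> E" "k \<in> pad E w" by auto
  then consider z where "e = x @ z" "y = z @ t # k" | x' where "x = e @ t # x'" "k = x' @ y"
    by (auto simp: append_eq_append_conv2 append_eq_Cons_conv)
  then show ?case
  proof cases
    case 1
    then have "x @ u @ z \<in> E'" using ek assms(3) by blast
    moreover have "k \<in> pad E' w" using ek pad_mono[of E E' w] assms(3) by blast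
    ultimately have "(x @ u @ z) @ t # k \<in> pad E' (t # w)" unfolding pad.simps by blast
    then show ?thesis using 1 by simp
  next
    case 2
    then have "x' @ u @ y \<in> pad E' w" using Cons.IH ek by blast
    moreover have "e \<in> E'" using ek assms(3) by blast
    ultimately have "e @ t # (x' @ u @ y) \<in> pad E' (t # w)" by auto
    then show ?thesis using 2 by simp
  qed
qed

text \<open>An \<open>ins\<close> step serves one gap only, whereas \<open>E'\<close> may be used in
  many gaps; the induction on \<open>v\<close> spends one step per gap with a new filling, and
  \<open>x\<close> absorbs the terms passed.\<close>

lemma root_evol_pad_insert:
  assumes "(b, u1) \<in> I" "hsteps u1 u" "E' = E \<union> {e1 @ u @ e2 | e1 e2. e1 @ e2 \<in> E}"
    and "\<And>k. k \<in> pad E v \<Longrightarrow> root_evol a w l b (x @ k @ y) r" "k \<in> pad E' v"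
  shows "root_evol a w l b (x @ k @ y) r"
  using assms(4,5)
proof (induction v arbitrary: x k)
  case (Cons t v)
  then obtain e k' where ek: "k = e @ t # k'" "e \<in> E'" "k' \<in> pad E' v" by auto
  have evol: "root_evol a w l b ((x @ f @ [t]) @ k' @ y) r" if f: "f \<in> E" for f
  proof (rule Cons.IH[OF _ ek(3)])
    fix j assume "j \<in> pad E v"
    then have "f @ t # j \<in> pad E (t # v)" using f by auto
    from Cons.prems(1)[OF this] show "root_evol a w l b ((x @ f @ [t]) @ j @ y) r" by simp
  qed
  from ek(2) assms(3) consider "e \<in> E" | e1 e2 where "e = e1 @ u @ e2" "e1 @ e2 \<in> E" by blast
  then show ?case
  proof cases
    case 1
    then show ?thesis using evol[of e] ek by simp
  next
    case 2
    then show ?thesis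
      using evol[of "e1 @ e2"] root_evol.ins[of a w l b "x @ e1" "e2 @ t # k' @ y", OF _ assms(1,2)] ek
      by simp
  qed
qed simp

text \<open>The evolution touches the terms of \<open>w\<close> only by inserting between them, and
  what is inserted into one gap can be inserted into every gap. Hence a set \<open>E\<close> of
  fillings, with \<open>x\<close> and \<open>y\<close> around, serves for every content
  \<open>w'\<close>.\<close>

lemma root_evol_uniform:
  assumes "root_evol a w l b m r"
  shows "\<exists>E x m0 y. m = x @ m0 @ y \<and> m0 \<in> pad E w \<and>
    (\<forall>w'. \<forall>k \<in> pad E w'. root_evol a w' l b (x @ k @ y) r)"
  using assms
proof (induction rule: root_evol.induct)
  case (refl w)
  \<comment> \<open>Nothing has been inserted yet: \<open>pad {[]} w\<close> is
    \<open>{w}\<close>.\<close>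
  show ?case
    by (intro exI[of _ "{[]}"] exI[of _ "[]"] exI[of _ w]) (auto intro: root_evol.refl)
next
  case (wrap w l b m r l1 u1 v1 r1 c l' u v r')
  then obtain E x m0 y where IH: "m = x @ m0 @ y" "m0 \<in> pad E w"
    "\<And>w' k. k \<in> pad E w' \<Longrightarrow> root_evol a w' l b (x @ k @ y) r" by blast
  have "root_evol a w' (l @ l') c ((u @ x) @ k @ (y @ v)) (r' @ r)" if "k \<in> pad E w'" for w' k
    using root_evol.wrap[OF IH(3)[OF that] wrap.hyps(2-)] by simp
  then show ?case
    using IH by (intro exI[of _ E] exI[of _ "u @ x"] exI[of _ m0] exI[of _ "y @ v"]) auto
next
  case (ins w l b m m' r u1 u)
  then obtain E x m0 y where IH: "m @ m' = x @ m0 @ y" "m0 \<in> pad E w"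
    "\<And>w' k. k \<in> pad E w' \<Longrightarrow> root_evol a w' l b (x @ k @ y) r" by blast
  note step = root_evol.ins[OF _ ins.hyps(2,3)]
  \<comment> \<open>The insertion falls before, behind or inside \<open>m0\<close>. Directly behind
    \<open>m0\<close> it counts towards \<open>y\<close>, as \<open>pad\<close> has no gap there;
    hence \<open>z' \<noteq> []\<close> in the last case.\<close>
  from IH(1) consider z where "x = m @ z" "m' = z @ m0 @ y"
    | z where "y = z @ m'" "m = x @ m0 @ z"
    | z z' where "m0 = z @ z'" "z' \<noteq> []" "m = x @ z" "m' = z' @ y"
    by (auto simp: append_eq_append_conv2) metis
  then show ?case
  proof cases
    case 1
    then have "root_evol a w' l b ((m @ u @ z) @ k @ y) r" if "k \<in> pad E w'" for w' k
      using IH(3)[OF that] step[of a w' l m "z @ k @ y" r] by simp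
    then show ?thesis
      using 1 IH by (intro exI[of _ E] exI[of _ "m @ u @ z"] exI[of _ m0] exI[of _ y]) auto
  next
    case 2
    then have "root_evol a w' l b (x @ k @ (z @ u @ m')) r" if "k \<in> pad E w'" for w' k
      using IH(3)[OF that] step[of a w' l "x @ k @ z" m' r] by simp
    then show ?thesis
      using 2 IH by (intro exI[of _ E] exI[of _ x] exI[of _ m0] exI[of _ "z @ u @ m'"]) auto
  next
    case 3
    define E' where "E' = E \<union> {e1 @ u @ e2 | e1 e2. e1 @ e2 \<in> E}"
    have "z @ u @ z' \<in> pad E' w" using pad_insert 3 IH(2) E'_def by blast
    moreover have "root_evol a w' l b (x @ k @ y) r" if "k \<in> pad E' w'" for w' k
      using root_evol_pad_insert[OF ins.hyps(2,3) E'_def IH(3) that] .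
    ultimately show ?thesis
      using 3 by (intro exI[of _ E'] exI[of _ x] exI[of _ "z @ u @ z'"] exI[of _ y]) auto
  qed
qed

text \<open>Omitting the insertions keeps \<open>l\<close>, \<open>b\<close> and \<open>r\<close>,
  and wraps apply to any content. This serves replacements, which discard the content.\<close>

lemma root_evol_any:
  "root_evol a w l b m r \<Longrightarrow> \<exists>m'. root_evol a w' l b m' r"
  by (induction rule: root_evol.induct) (blast intro: root_evol.refl root_evol.wrap)+

end

section \<open>A congruence of finite index\<close>

text \<open>For \<open>\<rho> = Id_on S\<close> this is the plain action of the hedge; in general
  \<open>\<rho>\<close> stands for the joint action of the fillings allowed before a term.\<close>

primrec gap_rel :: "'s set \<Rightarrow> (('a, 'v) tm \<Rightarrow> ('s \<times> 's) set) \<Rightarrow> ('s \<times> 's) set \<Rightarrow> ('a, 'v) hedge \<Rightarrow>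
    ('s \<times> 's) set" where
  "gap_rel S B \<rho> [] = Id_on S"
| "gap_rel S B \<rho> (t # h) = \<rho> O B t O gap_rel S B \<rho> h"

text \<open>As the action of a node is an image under \<open>\<Phi>\<close>, each of its pairs is
  justified by a single pair of the content; transferring pairs one at a time suffices.\<close>

locale observed_hedge_system = hedge_system W I P C
  for W :: "('a \<times> ('a, 'v) hedge \<times> ('a, 'v) hedge \<times> ('a, 'v) hedge \<times> ('a, 'v) hedge \<times> 'a) set"
    and I P C +
  fixes S :: "'s set"
    and B :: "('a, 'v) tm \<Rightarrow> ('s \<times> 's) set"
    and \<Phi> :: "'a \<Rightarrow> (('s \<times> 's) \<times> ('s \<times> 's)) set"
  assumes B_subset: "B t \<subseteq> S \<times> S"
    and B_Node: "B (Node a h) = \<Phi> a `` gap_rel S B (Id_on S) h"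
begin

abbreviation rel :: "('s \<times> 's) set \<Rightarrow> ('a, 'v) hedge \<Rightarrow> ('s \<times> 's) set" where
  "rel \<equiv> gap_rel S B"

lemma rel_subset: "rel \<rho> h \<subseteq> S \<times> S" if "\<rho> \<subseteq> S \<times> S"
  using that B_subset by (induction h) fastforce+

lemma rel_append: "rel \<rho> (h @ h') = rel \<rho> h O rel \<rho> h'" if "\<rho> \<subseteq> S \<times> S"
proof (induction h)
  case Nil
  then show ?case using rel_subset[OF that, of h'] by auto
qed (simp add: O_assoc)

text \<open>A term \<open>t\<close> with filling \<open>e\<close> acts as
  \<open>rel \<rho> e O \<rho> O B t\<close>. Fillings are chosen independently and composition
  distributes over unions, so padding amounts to a change of \<open>\<rho>\<close>.\<close>

lemma rel_pad:
  assumes "\<rho> \<subseteq> S \<times> S"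
  shows "(\<Union>k \<in> pad E w. rel \<rho> k) = rel (\<Union>e \<in> E. rel \<rho> e O \<rho>) w"
proof (induction w)
  case (Cons t w)
  have "(\<Union>k \<in> pad E (t # w). rel \<rho> k) = (\<Union>e \<in> E. \<Union>k \<in> pad E w. rel \<rho> (e @ t # k))"
    by auto
  also have "\<dots> = (\<Union>e \<in> E. rel \<rho> e O \<rho>) O B t O (\<Union>k \<in> pad E w. rel \<rho> k)"
    unfolding rel_append[OF assms] gap_rel.simps by blast
  finally show ?case using Cons.IH by simp
qed simp

section \<open>Relations observed along derivations\<close>

definition reach :: "('s \<times> 's) set \<Rightarrow> ('a, 'v) hedge \<Rightarrow> ('s \<times> 's) set" where
  "reach \<rho> h = (\<Union>h' \<in> {h'. hsteps h h'}. rel \<rho> h')"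

lemma reach_append: "reach \<rho> (h1 @ h2) = reach \<rho> h1 O reach \<rho> h2" if "\<rho> \<subseteq> S \<times> S"
proof -
  have "reach \<rho> (h1 @ h2) = (\<Union>h1' \<in> {h'. hsteps h1 h'}. \<Union>h2' \<in> {h'. hsteps h2 h'}. rel \<rho> (h1' @ h2'))"
    unfolding reach_def by (auto elim!: hsteps_appendE intro: hsteps_append)
  then show ?thesis
    by (simp only: reach_def rel_append[OF that] relcomp_UNION_distrib relcomp_UNION_distrib2)
      (rule SUP_commute)
qed

text \<open>By uniformity the middle part of \<open>m\<close> is observed on \<open>w\<close>
  through the relation induced by \<open>E\<close>. The assumption is applied to that relation
  instead of \<open>\<rho>\<close>; this is why hedges are compared under all relations on
  \<open>S\<close>.\<close>

lemma root_evol_transfer: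
  assumes "root_evol a w l b m r" "hsteps h w" "p \<in> rel \<rho> m" "\<rho> \<subseteq> S \<times> S"
    and "\<And>\<rho>. \<rho> \<subseteq> S \<times> S \<Longrightarrow> reach \<rho> h \<subseteq> reach \<rho> h'"
  shows "\<exists>w' m'. hsteps h' w' \<and> root_evol a w' l b m' r \<and> p \<in> rel \<rho> m'"
proof -
  obtain E x m0 y where E: "m = x @ m0 @ y" "m0 \<in> pad E w"
    "\<And>w' k. k \<in> pad E w' \<Longrightarrow> root_evol a w' l b (x @ k @ y) r"
    using root_evol_uniform[OF assms(1)] by blast
  define \<rho>' where "\<rho>' = (\<Union>e \<in> E. rel \<rho> e O \<rho>)"
  have \<rho>': "\<rho>' \<subseteq> S \<times> S" using rel_subset[OF assms(4)] assms(4) unfolding \<rho>'_def by fast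
  obtain s s1 s2 s' where p: "p = (s, s')"
    "(s, s1) \<in> rel \<rho> x" "(s1, s2) \<in> rel \<rho> m0" "(s2, s') \<in> rel \<rho> y"
    using assms(3) unfolding E(1) rel_append[OF assms(4)] by (auto elim!: relcompE)
  have "(s1, s2) \<in> rel \<rho>' w"
    unfolding \<rho>'_def rel_pad[OF assms(4), symmetric] using p(3) E(2) by (rule UN_I[rotated])
  then have "(s1, s2) \<in> reach \<rho>' h" using assms(2) unfolding reach_def by (auto intro: UN_I)
  then have "(s1, s2) \<in> reach \<rho>' h'" using assms(5)[OF \<rho>'] by (rule rev_subsetD)
  then obtain w' where w': "hsteps h' w'" "(s1, s2) \<in> rel \<rho>' w'" by (auto simp: reach_def)
  then obtain k where k: "k \<in> pad E w'" "(s1, s2) \<in> rel \<rho> k"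
    unfolding \<rho>'_def rel_pad[OF assms(4), symmetric] by (elim UN_E)
  then have "p \<in> rel \<rho> (x @ k @ y)"
    using p unfolding rel_append[OF assms(4)] by (auto intro: relcompI)
  then show ?thesis using w'(1) E(3)[OF k(1)] by (intro exI conjI)
qed

text \<open>The derivation is reordered so that steps on the content come first; the pair
  contributed by the content of the root is then carried over to \<open>h'\<close>.\<close>

lemma reach_Node_mono:
  assumes "\<And>\<rho>. \<rho> \<subseteq> S \<times> S \<Longrightarrow> reach \<rho> h \<subseteq> reach \<rho> h'" and \<rho>: "\<rho> \<subseteq> S \<times> S"
  shows "reach \<rho> [Node a h] \<subseteq> reach \<rho> [Node a h']"
proof
  fix p assume "p \<in> reach \<rho> [Node a h]"
  then obtain k where k: "hsteps [Node a h] k" "p \<in> rel \<rho> k" unfolding reach_def by blast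
  then obtain w where w: "hsteps h w" "result a w k" using hsteps_Node_result by blast
  have "\<exists>w' k'. hsteps h' w' \<and> result a w' k' \<and> p \<in> rel \<rho> k'"
    using w(2)
  proof cases
    \<comment> \<open>The content of the surviving node is read without fillings, so it is
      transferred under \<open>Id_on S\<close>, while its siblings stay under
      \<open>\<rho>\<close>.\<close>
    case (stay l b m r)
    obtain s s1 s2 s3 s' where p: "p = (s, s')" "(s, s1) \<in> rel \<rho> l" "(s1, s2) \<in> \<rho>"
      "(s2, s3) \<in> B (Node b m)" "(s3, s') \<in> rel \<rho> r"
      using k(2) unfolding stay(1) rel_append[OF \<rho>] by (auto elim!: relcompE)
    from p(4) obtain q where q: "q \<in> rel (Id_on S) m" "(q, (s2, s3)) \<in> \<Phi> b"
      unfolding B_Node by (elim ImageE)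
    have "Id_on S \<subseteq> S \<times> S" by auto
    then obtain w' m' where *: "hsteps h' w'" "root_evol a w' l b m' r" "q \<in> rel (Id_on S) m'"
      using root_evol_transfer[OF stay(2) w(1) q(1) _ assms(1)] by blast
    have "(s2, s3) \<in> B (Node b m')"
      unfolding B_Node using q(2) *(3) by (rule ImageI)
    \<comment> \<open>\<open>rel\<close> of a single term ends with \<open>Id_on S\<close>.\<close>
    moreover have "s3 \<in> S" using p(4) B_subset by blast
    ultimately have "p \<in> rel \<rho> (l @ [Node b m'] @ r)"
      using p unfolding rel_append[OF \<rho>] by (auto intro!: relcompI)
    then show ?thesis using *(1) result.stay[OF *(2)] by blast
  next
    \<comment> \<open>The content surfaces among the siblings and is observed with the outer
      \<open>\<rho>\<close>.\<close>
    case (collapse l b m r)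
    obtain s s1 s2 s' where p: "p = (s, s')"
      "(s, s1) \<in> rel \<rho> l" "(s1, s2) \<in> rel \<rho> m" "(s2, s') \<in> rel \<rho> r"
      using k(2) unfolding collapse(1) rel_append[OF \<rho>] by (auto elim!: relcompE)
    obtain w' m' where *: "hsteps h' w'" "root_evol a w' l b m' r" "(s1, s2) \<in> rel \<rho> m'"
      using root_evol_transfer[OF collapse(2) w(1) p(3) \<rho> assms(1)] by blast
    then have "p \<in> rel \<rho> (l @ m' @ r)"
      using p unfolding rel_append[OF \<rho>] by (auto intro: relcompI)
    then show ?thesis using *(1) result.collapse[OF *(2) collapse(3)] by blast
  next
    \<comment> \<open>The content is discarded, so \<open>h'\<close> itself can serve, without any
      step.\<close>
    case (repl l b m r u1 u)
    from root_evol_any[OF repl(2), of h'] obtain m' where "root_evol a h' l b m' r" by blast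
    from result.repl[OF this repl(3,4)] show ?thesis using k(2) unfolding repl(1) by blast
  qed
  then obtain w' k' where *: "hsteps h' w'" "result a w' k'" "p \<in> rel \<rho> k'" by blast
  from rtranclp_trans[OF hsteps_Node[OF *(1)] result_hsteps[OF *(2)]] *(3)
  show "p \<in> reach \<rho> [Node a h']" unfolding reach_def by (auto intro: UN_I)
qed

text \<open>The function from \<open>\<rho>\<close> to \<open>reach \<rho> h\<close>, coded as a set
  of pairs and restricted to relations on \<open>S\<close>, so that all values lie in one finite
  power set.\<close>

definition behaviour :: "('a, 'v) hedge \<Rightarrow> (('s \<times> 's) set \<times> ('s \<times> 's)) set" where
  "behaviour h = {(\<rho>, p). \<rho> \<subseteq> S \<times> S \<and> p \<in> reach \<rho> h}"

lemma behaviour_eq_iff: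
  "behaviour h = behaviour h' \<longleftrightarrow> (\<forall>\<rho>. \<rho> \<subseteq> S \<times> S \<longrightarrow> reach \<rho> h = reach \<rho> h')"
  unfolding behaviour_def set_eq_iff by auto

lemma behaviour_append:
  "behaviour h1 = behaviour h1' \<Longrightarrow> behaviour h2 = behaviour h2' \<Longrightarrow>
    behaviour (h1 @ h2) = behaviour (h1' @ h2')"
  by (simp add: behaviour_eq_iff reach_append)

lemma behaviour_Node:
  "behaviour h = behaviour h' \<Longrightarrow> behaviour [Node a h] = behaviour [Node a h']"
  unfolding behaviour_eq_iff
  by (intro allI impI equalityI; rule reach_Node_mono; simp)

lemma reach_subset: "\<rho> \<subseteq> S \<times> S \<Longrightarrow> reach \<rho> h \<subseteq> S \<times> S"
  unfolding reach_def using rel_subset by (intro UN_least)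

lemma finite_range_behaviour: "finite S \<Longrightarrow> finite (range behaviour)"
proof (rule finite_subset)
  show "range behaviour \<subseteq> Pow (Pow (S \<times> S) \<times> (S \<times> S))"
  proof (intro image_subsetI PowI subsetI)
    fix h x assume "x \<in> behaviour h"
    then show "x \<in> Pow (S \<times> S) \<times> (S \<times> S)"
      unfolding behaviour_def using reach_subset[of "fst x" h] by (cases x) auto
  qed
qed simp

end

section \<open>Contexts\<close>

lemma subst_append [simp]: "subst \<sigma> (h @ h') = subst \<sigma> h @ subst \<sigma> h'"
  by (simp add: subst_def)

lemma subst_Nil [simp]: "subst \<sigma> [] = []"
  by (simp add: subst_def)

lemma subst_Cons: "subst \<sigma> (t # h) = subst_tm \<sigma> t @ subst \<sigma> h"
  by (simp add: subst_def)

lemma ground_simps [simp]: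
  "ground []"
  "ground (t # h) \<longleftrightarrow> vars t = {} \<and> ground h"
  "ground (h @ h') \<longleftrightarrow> ground h \<and> ground h'"
  by (auto simp: ground_def)

lemma vars_Node_ground [simp]: "vars (Node f h) = {} \<longleftrightarrow> ground h"
  by (auto simp: ground_def)

lemma concat_map_id: "(\<And>x. x \<in> set xs \<Longrightarrow> f x = [x]) \<Longrightarrow> concat (map f xs) = xs"
  by (induction xs) auto

lemma occ_tm_eq_0_subst_tm: "occ_tm x t = 0 \<Longrightarrow> subst_tm (\<lambda>y. if y = x then h else [Var y]) t = [t]"
  by (induction t) (auto intro!: concat_map_id)

lemma subst_tm_ground: "vars t = {} \<Longrightarrow> subst_tm \<sigma> t = [t]"
  by (induction t) (auto intro!: concat_map_id)

lemma subst_ground [simp]: "ground h \<Longrightarrow> subst \<sigma> h = h"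
  by (induction h) (auto simp: subst_Cons subst_tm_ground)

lemma occ_append [simp]: "occ x (h @ h') = occ x h + occ x h'"
  by (simp add: occ_def)

lemma occ_tm_ground: "vars t = {} \<Longrightarrow> occ_tm x t = 0"
  by (induction t) auto

lemma occ_ground [simp]: "ground h \<Longrightarrow> occ x h = 0"
  by (auto simp: occ_def ground_def occ_tm_ground)

text \<open>Descending along the only path to the distinguished variable replaces the occurrence
  count by structural closure; moves and rewriting both use this.\<close>

lemma plug_closed:
  fixes u :: "('f, 'v) ctxt"
  assumes "is_ctxt u" and "Q k k'"
    and Node: "\<And>f h h'. Q h h' \<Longrightarrow> Q [Node f h] [Node f h']"
    and append: "\<And>g h h' g'. Q h h' \<Longrightarrow> Q (g @ h @ g') (g @ h' @ g')"
  shows "Q (plug u k) (plug u k')"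
proof -
  define x where "x = fst u"
  define \<sigma> where "\<sigma> = (\<lambda>k :: ('f, 'v) hedge. \<lambda>y. if y = x then k else [Var y])"
  \<comment> \<open>The claim for single terms is a premise here, so that this serves inside the
    induction over terms and again at top level.\<close>
  have hedge: "Q (subst (\<sigma> k) h) (subst (\<sigma> k') h)"
    if "occ x h = 1"
      "\<And>t. t \<in> set h \<Longrightarrow> occ_tm x t = 1 \<Longrightarrow> Q (subst_tm (\<sigma> k) t) (subst_tm (\<sigma> k') t)" for h
    using that
  proof (induction h)
    case (Cons t h)
    from Cons.prems(1) consider "occ_tm x t = 1" "occ x h = 0" | "occ_tm x t = 0" "occ x h = 1"
      by (auto simp: occ_def add_is_1)
    then show ?case
    proof cases
      case 1
      then have "\<forall>s \<in> set h. occ_tm x s = 0" by (auto simp: occ_def)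
      then have "subst (\<sigma> j) h = h" for j
        by (auto simp: subst_def \<sigma>_def occ_tm_eq_0_subst_tm intro!: concat_map_id)
      then show ?thesis using append[of _ _ "[]" h] Cons.prems(2)[of t] 1 by (simp add: subst_Cons)
    next
      case 2
      then have "Q (subst (\<sigma> k) h) (subst (\<sigma> k') h)" using Cons by simp
      then show ?thesis
        using append[of _ _ "[t]" "[]"] 2 by (simp add: subst_Cons \<sigma>_def occ_tm_eq_0_subst_tm)
    qed
  qed (simp add: occ_def)
  have "Q (subst_tm (\<sigma> k) t) (subst_tm (\<sigma> k') t)" if "occ_tm x t = 1" for t
    using that
  proof (induction t)
    case (Var y)
    then show ?case using assms(2) by (auto simp: \<sigma>_def split: if_splits)
  next
    case (Node f ts)
    then have "Q (subst (\<sigma> k) ts) (subst (\<sigma> k') ts)" by (intro hedge) (auto simp: occ_def)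
    from assms(3)[OF this] show ?case by (simp add: subst_def)
  qed
  then show ?thesis
    using hedge[of "snd u"] assms(1) by (simp add: is_ctxt_def plug_def x_def \<sigma>_def)
qed

lemma plug_Var: "is_ctxt (x, [Var x])" "plug (x, [Var x]) h = h"
  by (simp_all add: is_ctxt_def occ_def plug_def subst_def)

text \<open>Ground neighbours contain no copy of the distinguished variable and are unaffected by
  plugging.\<close>

lemma plug_context:
  assumes "is_ctxt u" "ground g" "ground g'"
  shows "\<exists>u'. is_ctxt u' \<and> (\<forall>h. plug u' h = g @ plug u h @ g')"
  using assms by (intro exI[of _ "(fst u, g @ snd u @ g')"]) (simp add: is_ctxt_def plug_def)

lemma plug_Node:
  assumes "is_ctxt u"
  shows "\<exists>u'. is_ctxt u' \<and> (\<forall>h. plug u' h = [Node f (plug u h)])"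
  using assms
  by (intro exI[of _ "(fst u, [Node f (snd u)])"]) (simp add: is_ctxt_def plug_def subst_def occ_def)


section \<open>Evaluation by a hedge automaton\<close>

text \<open>Big-step form of \<open>move\<close>. States evaluate to themselves, so that it also
  applies to the intermediate hedges of a sequence of moves.\<close>

inductive red :: "('a, 'q) ha \<Rightarrow> ('a + 'q, 'v) tm \<Rightarrow> 'q \<Rightarrow> bool" for A where
  state: "red A (State q) q"
| trans: "(a, L, q) \<in> trans A \<Longrightarrow> w \<in> L \<Longrightarrow> list_all2 (red A) ts w \<Longrightarrow> red A (Sym a ts) q"

inductive_cases red_StateE: "red A (Node (Inr q) ts) q'"
inductive_cases red_SymE: "red A (Node (Inl a) ts) q"
inductive_cases red_VarE: "red A (Var x) q"

definition eval :: "('a, 'q) ha \<Rightarrow> ('a, 'v) tm \<Rightarrow> 'q \<Rightarrow> bool" where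
  "eval A t = red A (map_tm Inl id t)"

lemma list_all2_red_embed: "list_all2 (red A) (embed h) w \<longleftrightarrow> list_all2 (eval A) h w"
  by (simp add: embed_def list_all2_map1 eval_def[abs_def])

lemma eval_Node: "eval A (Node a h) q \<longleftrightarrow> (\<exists>L w. (a, L, q) \<in> trans A \<and> w \<in> L \<and> list_all2 (eval A) h w)"
  unfolding eval_def[abs_def]
  by (fastforce simp: list_all2_map1 elim!: red_SymE intro: red.trans)

lemma eval_Var [simp]: "\<not> eval A (Var x) q"
  by (auto simp: eval_def elim: red_VarE)

lemma list_all2_red_map_State: "list_all2 (red A) (map State w) w"
  by (induction w) (auto intro: red.state)

text \<open>The redex evaluates to the state replacing it, and evaluation is compositional, so an
  evaluation of the result lifts back to the source.\<close>

lemma move_red: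
  fixes g g' :: "('a + 'q, 'v) hedge"
  assumes "move A g g'" "list_all2 (red A) g' w"
  shows "list_all2 (red A) g w"
proof -
  define Q where
    "Q = (\<lambda>(g :: ('a + 'q, 'v) hedge) (g' :: ('a + 'q, 'v) hedge). \<forall>w. list_all2 (red A) g' w \<longrightarrow> list_all2 (red A) g w)"
  from assms(1) have "Q g g'"
  proof cases
    case (1 u a L q v)
    have "Q (plug u [Sym a (map State v)]) (plug u [State q])"
    proof (rule plug_closed[OF 1(3)])
      show "Q [Sym a (map State v)] [State q]"
        using red.trans[OF 1(4,5) list_all2_red_map_State]
        by (auto simp: Q_def list_all2_Cons1 elim!: red_StateE)
    next
      fix f and h h' :: "('a + 'q, 'v) hedge" assume "Q h h'"
      then show "Q [Node f h] [Node f h']"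
        unfolding Q_def
        by (cases f) (auto simp: list_all2_Cons1 elim!: red_StateE red_SymE intro: red.intros)
    next
      fix g h h' k :: "('a + 'q, 'v) hedge" assume "Q h h'"
      then show "Q (g @ h @ k) (g @ h' @ k)"
        unfolding Q_def
        by (metis (no_types) list_all2_append1 list_all2_appendI)
    qed
    then show ?thesis using 1 by simp
  qed
  then show ?thesis using assms(2) by (simp add: Q_def)
qed

lemma moves_red: "(move A)\<^sup>*\<^sup>* g g' \<Longrightarrow> list_all2 (red A) g' w \<Longrightarrow> list_all2 (red A) g w"
  by (induction rule: converse_rtranclp_induct) (auto intro: move_red)

section \<open>Moves that carry out an evaluation\<close>

lemma move_context:
  assumes "move A h h'" "ground g" "ground g'"
  shows "move A (g @ h @ g') (g @ h' @ g')"
  using assms(1)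
proof cases
  case (1 u a L q w)
  obtain u' where "is_ctxt u'" "\<And>h. plug u' h = g @ plug u h @ g'"
    using plug_context[OF 1(3) assms(2,3)] by blast
  then show ?thesis using move.intros[of u' a L q A w] 1 by simp
qed

lemma move_Node:
  assumes "move A h h'"
  shows "move A [Node f h] [Node f h']"
  using assms
proof cases
  case (1 u a L q w)
  obtain u' where "is_ctxt u'" "\<And>h. plug u' h = [Node f (plug u h)]"
    using plug_Node[OF 1(3)] by blast
  then show ?thesis using move.intros[of u' a L q A w] 1 by simp
qed

lemma moves_context:
  "(move A)\<^sup>*\<^sup>* h h' \<Longrightarrow> ground g \<Longrightarrow> ground g' \<Longrightarrow> (move A)\<^sup>*\<^sup>* (g @ h @ g') (g @ h' @ g')"
  by (induction rule: rtranclp_induct) (auto intro: move_context rtranclp.rtrancl_into_rtrancl)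

lemma moves_Node: "(move A)\<^sup>*\<^sup>* h h' \<Longrightarrow> (move A)\<^sup>*\<^sup>* [Node f h] [Node f h']"
  by (induction rule: rtranclp_induct) (auto intro: move_Node rtranclp.rtrancl_into_rtrancl)

lemma moves_map_State:
  assumes "list_all2 (\<lambda>t q. (move A)\<^sup>*\<^sup>* [t] [State q] \<and> vars t = {}) ts w"
  shows "(move A)\<^sup>*\<^sup>* ts (map State w) \<and> ground ts"
  using assms
proof (induction rule: list_all2_induct)
  case (Cons t ts q w)
  have "(move A)\<^sup>*\<^sup>* ([] @ [t] @ ts) ([] @ [State q] @ ts)"
    using Cons by (intro moves_context) auto
  moreover have "(move A)\<^sup>*\<^sup>* ([State q] @ ts @ []) ([State q] @ map State w @ [])"
    using Cons by (intro moves_context) auto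
  ultimately show ?case using Cons by simp
qed simp

lemma red_moves: "red A t q \<Longrightarrow> (move A)\<^sup>*\<^sup>* [t] [State q] \<and> vars t = {}"
proof (induction rule: red.induct)
  case (trans a L q w ts)
  then have *: "(move A)\<^sup>*\<^sup>* ts (map State w) \<and> ground ts"
    by (intro moves_map_State) (auto elim: list_all2_mono)
  then have "(move A)\<^sup>*\<^sup>* [Sym a ts] [Sym a (map State w)]" by (intro moves_Node) simp
  also have "move A [Sym a (map State w)] [State q]"
    using move.intros[OF plug_Var(1) trans(1,2)] by (simp add: plug_Var)
  finally have "(move A)\<^sup>*\<^sup>* [Sym a ts] [State q]" .
  then show ?case using * by (simp del: tm.set)
qed simp

lemma eval_ground: "eval A t q \<Longrightarrow> vars t = {}"
  using red_moves[of A "map_tm Inl id t" q] by (simp add: eval_def tm.set_map)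

text \<open>Moves reflect evaluations, and evaluations can be carried out by moves. In particular,
  automaton languages contain only single ground terms.\<close>

lemma mem_ha_lang_state_iff: "h \<in> ha_lang_state A q \<longleftrightarrow> (\<exists>t. h = [t] \<and> eval A t q)"
proof
  assume "h \<in> ha_lang_state A q"
  then have "list_all2 (red A) (embed h) [q]"
    using moves_red[of A "embed h" "[State q]" "[q]"]
    by (simp add: ha_lang_state_def red.state)
  then show "\<exists>t. h = [t] \<and> eval A t q"
    unfolding list_all2_red_embed by (auto simp: list_all2_Cons2)
next
  assume "\<exists>t. h = [t] \<and> eval A t q"
  then obtain t where "h = [t]" "eval A t q" by blast
  then show "h \<in> ha_lang_state A q"
    using red_moves[of A "map_tm Inl id t" q] eval_ground[of A t q]
    by (simp add: ha_lang_state_def embed_def eval_def)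
qed

section \<open>Recognition by a finite congruence\<close>

text \<open>\<open>regular\<close> asks for natural numbers as states; an injection renames a finite
  automaton over any type.\<close>

lemma regularI:
  assumes "finite S" "s0 \<in> S" "F \<subseteq> S" "\<And>s q. s \<in> S \<Longrightarrow> q \<in> Q \<Longrightarrow> \<delta> s q \<in> S"
  shows "regular Q {w \<in> lists Q. foldl \<delta> s0 w \<in> F}"
proof -
  obtain f :: "'a \<Rightarrow> nat" where f: "inj_on f S"
    using assms(1) by (meson countable_finite countableE)
  define g where "g = inv_into S f"
  have gf: "g (f s) = s" if "s \<in> S" for s using f that by (simp add: g_def)
  have fold: "foldl (\<lambda>n q. f (\<delta> (g n) q)) (f s) w = f (foldl \<delta> s w) \<and> foldl \<delta> s w \<in> S"
    if "w \<in> lists Q" "s \<in> S" for s w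
    using that by (induction w arbitrary: s) (auto simp: gf assms(4))
  have "foldl (\<lambda>n q. f (\<delta> (g n) q)) (f s0) w \<in> f ` F \<longleftrightarrow> foldl \<delta> s0 w \<in> F" if "w \<in> lists Q" for w
    using fold[OF that assms(2)] inj_on_image_mem_iff[OF f _ assms(3)] by simp
  then have "{w \<in> lists Q. foldl \<delta> s0 w \<in> F} =
      {w \<in> lists Q. foldl (\<lambda>n q. f (\<delta> (g n) q)) (f s0) w \<in> f ` F}" by blast
  then show ?thesis
    unfolding regular_def using assms gf
    by (intro exI[of _ "f ` S"] exI[of _ "f s0"] exI[of _ "\<lambda>n q. f (\<delta> (g n) q)"] exI[of _ "f ` F"])
      auto
qed

text \<open>Myhill-Nerode construction: the values of \<open>\<tau>\<close> are the states, and the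
  product of the classes of the children together with the label determines the class of a
  node.\<close>

lemma HA_language_congruence:
  fixes \<tau> :: "('a::finite, 'v) hedge \<Rightarrow> 'm"
  assumes finite: "finite (range \<tau>)"
    and append: "\<And>h1 h1' h2 h2'. \<tau> h1 = \<tau> h1' \<Longrightarrow> \<tau> h2 = \<tau> h2' \<Longrightarrow> \<tau> (h1 @ h2) = \<tau> (h1' @ h2')"
    and congr_Node: "\<And>h h' a. \<tau> h = \<tau> h' \<Longrightarrow> \<tau> [Node a h] = \<tau> [Node a h']"
  shows "HA_language {h \<in> ground_terms. \<tau> h \<in> M}"
proof -
  define rep where "rep = inv_into UNIV \<tau>"
  have rep: "\<tau> (rep (\<tau> h)) = \<tau> h" for h by (simp add: rep_def f_inv_into_f)
  \<comment> \<open>The product of classes induced by concatenation, computed on representatives;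
    \<open>L m\<close> below holds the words with product \<open>m\<close>.\<close>
  define \<delta> where "\<delta> m q = \<tau> (rep m @ rep q)" for m q
  define Q where "Q = range \<tau>"
  define L where "L m = {w \<in> lists Q. foldl \<delta> (\<tau> []) w \<in> {m}}" for m
  define A where "A = \<lparr>states = Q, final = M \<inter> Q,
    trans = (\<lambda>(a, m). (a, L m, \<tau> [Node a (rep m)])) ` (UNIV \<times> Q)\<rparr>"
  have "regular Q (L m)" if "m \<in> Q" for m
    unfolding L_def using finite that by (intro regularI[where S = Q]) (auto simp: Q_def \<delta>_def)
  then have "is_ha A" using finite by (auto simp: is_ha_def A_def Q_def)
  have transA: "(a, K, q) \<in> trans A \<longleftrightarrow> (\<exists>m \<in> Q. K = L m \<and> q = \<tau> [Node a (rep m)])" for a K q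
    by (auto simp: A_def)
  have \<delta>: "\<delta> (\<tau> h) (\<tau> k) = \<tau> (h @ k)" for h k
    unfolding \<delta>_def by (intro append rep)
  have fold: "foldl \<delta> (\<tau> h) (map (\<lambda>t. \<tau> [t]) ts) = \<tau> (h @ ts)" for h ts
    by (induction ts arbitrary: h) (simp_all add: \<delta>)
  \<comment> \<open>The automaton is deterministic: a ground term evaluates to its own class
    only.\<close>
  have "eval A t q \<longleftrightarrow> vars t = {} \<and> q = \<tau> [t]" for t q
  proof (induction t arbitrary: q)
    case (Node a ts)
    have all2: "list_all2 (eval A) ts w \<longleftrightarrow> ground ts \<and> w = map (\<lambda>t. \<tau> [t]) ts" for w
      using Node.IH
    proof (induction ts arbitrary: w)
      case (Cons t ts)
      then show ?case by (auto simp: list_all2_Cons1)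
    qed simp
    have "eval A (Node a ts) q \<longleftrightarrow> (\<exists>m \<in> Q. q = \<tau> [Node a (rep m)] \<and> ground ts \<and>
        map (\<lambda>t. \<tau> [t]) ts \<in> L m)"
      unfolding eval_Node all2 transA by blast
    also have "\<dots> \<longleftrightarrow> ground ts \<and> q = \<tau> [Node a (rep (\<tau> ts))]"
      using fold[of "[]" ts] by (auto simp: L_def Q_def intro!: exI[of _ ts])
    also have "\<tau> [Node a (rep (\<tau> ts))] = \<tau> [Node a ts]" by (intro congr_Node rep)
    finally show ?case by (simp del: tm.set)
  qed simp
  then have "ha_lang A = {h \<in> ground_terms. \<tau> h \<in> M}"
    by (auto simp: ha_lang_def mem_ha_lang_state_iff ground_terms_def A_def Q_def)
  with HA_language_ha_lang[OF \<open>is_ha A\<close>] show ?thesis by metis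
qed


section \<open>Rewriting of ground hedges\<close>

lemma inst_simps:
  "inst_hedge A [] h \<longleftrightarrow> h = []"
  "inst_hedge A (t # ts) h \<longleftrightarrow> (\<exists>h1 h2. h = h1 @ h2 \<and> inst_tm A t h1 \<and> inst_hedge A ts h2)"
  "inst_tm A (Var x) h \<longleftrightarrow> h = [Var x]"
  "inst_tm A (State q) h \<longleftrightarrow> h \<in> ha_lang_state A q"
  "inst_tm A (Sym a ts) h \<longleftrightarrow> (\<exists>k. h = [Node a k] \<and> inst_hedge A ts k)"
  by ((rule iffI, (erule inst_hedge.cases inst_tm.cases; fastforce),
      (fastforce intro: inst_tm_inst_hedge.intros))+)

lemma ha_lang_state_ground: "h \<in> ha_lang_state A q \<Longrightarrow> ground h"
  by (simp add: ha_lang_state_def)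

lemma inst_hedge_map_State_ground: "inst_hedge A (map State qs) h \<Longrightarrow> ground h"
  by (induction qs arbitrary: h) (auto simp: inst_simps ha_lang_state_ground)

section \<open>Rule instances, sorted into the four kinds of root steps\<close>

definition wraps :: "('a, 'q) ha \<Rightarrow> ('a, 'q, 'v) prule set \<Rightarrow>
    ('a \<times> ('a, 'v) hedge \<times> ('a, 'v) hedge \<times> ('a, 'v) hedge \<times> ('a, 'v) hedge \<times> 'a) set" where
  "wraps A R = {(a, l, u, v, r, b). ground l \<and> ground u \<and> ground v \<and> ground r \<and>
    (\<exists>x s. ([Node a [Var x]], s) \<in> R \<and> inst_hedge A s (l @ [Node b (u @ [Var x] @ v)] @ r))}"

definition inserts :: "('a, 'q) ha \<Rightarrow> ('a, 'q, 'v) prule set \<Rightarrow> ('a \<times> ('a, 'v) hedge) set" where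
  "inserts A R = {(a, u). ground u \<and>
    (\<exists>x y s. x \<noteq> y \<and> ([Node a [Var x, Var y]], s) \<in> R \<and>
      inst_hedge A s [Node a ([Var x] @ u @ [Var y])])}"

definition replacements :: "('a, 'q) ha \<Rightarrow> ('a, 'q, 'v) prule set \<Rightarrow> ('a \<times> ('a, 'v) hedge) set" where
  "replacements A R = {(a, u). ground u \<and> (\<exists>x s. ([Node a [Var x]], s) \<in> R \<and> inst_hedge A s u)}"

definition collapses :: "('a, 'q, 'v) prule set \<Rightarrow> 'a set" where
  "collapses R = {a. \<exists>x. ([Node a [Var x]], [Var x]) \<in> R}"

lemma rewriteI:
  "(l, r) \<in> R \<Longrightarrow> inst_hedge A r r' \<Longrightarrow> is_subst \<sigma> \<Longrightarrow> rewrite A R (subst \<sigma> l) (subst \<sigma> r')"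
  using rewrite.intros[OF _ _ plug_Var(1), of l r R A r' \<sigma>] by (simp only: plug_Var(2))

lemma rewrite_context:
  assumes "rewrite A R h h'" "ground g" "ground g'"
  shows "rewrite A R (g @ h @ g') (g @ h' @ g')"
  using assms(1)
proof cases
  case (1 l r r' u \<sigma>)
  obtain u' where "is_ctxt u'" "\<And>h. plug u' h = g @ plug u h @ g'"
    using plug_context[OF 1(5) assms(2,3)] by blast
  then show ?thesis using rewrite.intros[of l r R A r' u' \<sigma>] 1 by simp
qed

lemma rewrite_Node:
  assumes "rewrite A R h h'"
  shows "rewrite A R [Node f h] [Node f h']"
  using assms
proof cases
  case (1 l r r' u \<sigma>)
  obtain u' where "is_ctxt u'" "\<And>h. plug u' h = [Node f (plug u h)]"
    using plug_Node[OF 1(5)] by blast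
  then show ?thesis using rewrite.intros[of l r R A r' u' \<sigma>] 1 by simp
qed

locale xacu_plus_ptrs =
  fixes A :: "('a, 'q) ha" and R :: "('a, 'q, 'v) prule set"
  assumes xacu: "xacu_plus A R"
begin

sublocale hedge_system "wraps A R" "inserts A R" "replacements A R" "collapses R" .

lemma tstep_ground: "tstep t k \<Longrightarrow> vars t = {} \<Longrightarrow> ground k"
  by (induction rule: tstep.induct)
    (auto simp: wraps_def inserts_def replacements_def simp del: tm.set)

lemma hstep_ground: "hstep h h' \<Longrightarrow> ground h \<Longrightarrow> ground h'"
  by (auto simp: hstep_def dest: tstep_ground)

lemma tstep_rewrite: "tstep t k \<Longrightarrow> vars t = {} \<Longrightarrow> rewrite A R [t] k"
proof (induction rule: tstep.induct)
  case (wrap a l u v r b m)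
  then obtain x s where *: "ground l" "ground u" "ground v" "ground r"
    "([Node a [Var x]], s) \<in> R" "inst_hedge A s (l @ [Node b (u @ [Var x] @ v)] @ r)"
    by (auto simp: wraps_def)
  \<comment> \<open>The whole content goes to \<open>x\<close>; the ground hedges \<open>l\<close>,
    \<open>u\<close>, \<open>v\<close>, \<open>r\<close> are unaffected.\<close>
  let ?\<sigma> = "\<lambda>y. if y = x then m else [Var y]"
  have "is_subst ?\<sigma>" by (auto simp: is_subst_def intro: finite_subset[of _ "{x}"])
  from rewriteI[OF *(5,6) this] show ?case
    using *(1-4) by (simp add: subst_Cons flip: subst_def)
next
  case (ins a u m m')
  then obtain x y s where *: "ground u" "x \<noteq> y"
    "([Node a [Var x, Var y]], s) \<in> R" "inst_hedge A s [Node a ([Var x] @ u @ [Var y])]"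
    by (auto simp: inserts_def)
  let ?\<sigma> = "\<lambda>z. if z = x then m else if z = y then m' else [Var z]"
  have "is_subst ?\<sigma>" by (auto simp: is_subst_def intro: finite_subset[of _ "{x, y}"])
  from rewriteI[OF *(3,4) this] show ?case
    using *(1,2) by (simp add: subst_Cons flip: subst_def)
next
  case (repl a u m)
  then obtain x s where *: "ground u" "([Node a [Var x]], s) \<in> R" "inst_hedge A s u"
    by (auto simp: replacements_def)
  let ?\<sigma> = "\<lambda>y. if y = x then m else [Var y]"
  have "is_subst ?\<sigma>" by (auto simp: is_subst_def intro: finite_subset[of _ "{x}"])
  from rewriteI[OF *(2,3) this] show ?case
    using *(1) by (simp add: subst_Cons flip: subst_def)
next
  case (collapse a m)
  then obtain x where *: "([Node a [Var x]], [Var x]) \<in> R" by (auto simp: collapses_def)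
  have inst: "inst_hedge A [Var x] [Var x]" by (simp add: inst_simps)
  let ?\<sigma> = "\<lambda>y. if y = x then m else [Var y]"
  have "is_subst ?\<sigma>" by (auto simp: is_subst_def intro: finite_subset[of _ "{x}"])
  from rewriteI[OF * inst this] show ?case
    by (simp add: subst_Cons flip: subst_def)
next
  case (inner t k a g g')
  then have "rewrite A R (g @ [t] @ g') (g @ k @ g')"
    by (intro rewrite_context) (auto simp del: tm.set)
  then show ?case using rewrite_Node by fastforce
qed

lemma hstep_rewrite: "hstep h h' \<Longrightarrow> ground h \<Longrightarrow> rewrite A R h h'"
  using rewrite_context[OF tstep_rewrite] by (fastforce simp: hstep_def)

text \<open>Rules with two variables give insertions, right-hand sides without variables
  replacements, \<open>a(x) -> x\<close> a collapse, all others wraps with some hedges empty. Hedges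
  put in for states are ground, so the substitution leaves them alone.\<close>

lemma rewrite_rule_tstep:
  assumes "(l, r) \<in> R" "inst_hedge A r r'"
  obtains t where "subst \<sigma> l = [t]" "tstep t (subst \<sigma> r')"
proof -
  have wrapI: "tstep (Node a (\<sigma> x)) (subst \<sigma> (l @ [Node b (u @ [Var x] @ v)] @ r))"
    if "ground l" "ground u" "ground v" "ground r" "([Node a [Var x]], s) \<in> R"
      "inst_hedge A s (l @ [Node b (u @ [Var x] @ v)] @ r)" for a x l b u v r s
  proof -
    have "(a, l, u, v, r, b) \<in> wraps A R"
      using that unfolding wraps_def mem_Collect_eq prod.case by (intro conjI exI)
    from tstep.wrap[OF this, of "\<sigma> x"] show ?thesis
      using that by (simp add: subst_Cons flip: subst_def)
  qed
  have replI: "tstep (Node a (\<sigma> x)) (subst \<sigma> u)"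
    if "ground u" "([Node a [Var x]], s) \<in> R" "inst_hedge A s u" for a x u s
  proof -
    have "(a, u) \<in> replacements A R"
      using that unfolding replacements_def mem_Collect_eq prod.case by (intro conjI exI)
    from tstep.repl[OF this, of "\<sigma> x"] show ?thesis using that by simp
  qed
  have single: thesis if "l = [Node a [Var x]]" "tstep (Node a (\<sigma> x)) (subst \<sigma> r')" for a x
    using that \<open>\<And>t. subst \<sigma> l = [t] \<Longrightarrow> tstep t (subst \<sigma> r') \<Longrightarrow> thesis\<close> by (simp add: subst_def)
  from assms(1) xacu have "xacu_plus_rule A (l, r)" by (auto simp: xacu_plus_def)
  then show thesis
  proof cases
    case (1 a x b)
    then have "r' = [] @ [Node b ([] @ [Var x] @ [])] @ []"
      using assms(2) by (simp add: inst_simps)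
    with wrapI[of "[]" "[]" "[]" "[]" a x r b] show thesis
      using single[OF 1(1)] assms 1(1) by simp
  next
    case (2 p a x)
    then obtain u where u: "u \<in> ha_lang_state A p" and r': "r' = [] @ [Node a (u @ [Var x] @ [])] @ []"
      using assms(2) by (auto simp: inst_simps)
    have "tstep (Node a (\<sigma> x)) (subst \<sigma> r')"
      unfolding r' by (rule wrapI[where s = r]) (use assms 2 u r' ha_lang_state_ground in auto)
    then show thesis using single[OF 2(1)] by blast
  next
    case (3 p a x)
    then obtain u where u: "u \<in> ha_lang_state A p" and r': "r' = [] @ [Node a ([] @ [Var x] @ u)] @ []"
      using assms(2) by (auto simp: inst_simps)
    have "tstep (Node a (\<sigma> x)) (subst \<sigma> r')"
      unfolding r' by (rule wrapI[where s = r]) (use assms 3 u r' ha_lang_state_ground in auto)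
    then show thesis using single[OF 3(1)] by blast
  next
    case (4 p x y a)
    then obtain u where u: "u \<in> ha_lang_state A p" "r' = [Node a ([Var x] @ u @ [Var y])]"
      using assms(2) by (auto simp: inst_simps)
    have "([Node a [Var x, Var y]], r) \<in> R" using assms(1) 4(1) by simp
    with ha_lang_state_ground[OF u(1)] \<open>x \<noteq> y\<close> assms(2)[unfolded u(2)]
    have "(a, u) \<in> inserts A R"
      unfolding inserts_def mem_Collect_eq prod.case by (intro conjI exI)
    from tstep.ins[OF this, of "\<sigma> x" "\<sigma> y"] have "tstep (Node a (\<sigma> x @ \<sigma> y)) (subst \<sigma> r')"
      using u by (simp add: subst_Cons ha_lang_state_ground flip: subst_def)
    moreover have "subst \<sigma> l = [Node a (\<sigma> x @ \<sigma> y)]" using 4 by (simp add: subst_def)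
    ultimately show thesis using that by blast
  next
    case (5 p a x)
    then obtain u where u: "u \<in> ha_lang_state A p" and r': "r' = u @ [Node a ([] @ [Var x] @ [])] @ []"
      using assms(2) by (auto simp: inst_simps)
    have "tstep (Node a (\<sigma> x)) (subst \<sigma> r')"
      unfolding r' by (rule wrapI[where s = r]) (use assms 5 u r' ha_lang_state_ground in auto)
    then show thesis using single[OF 5(1)] by blast
  next
    case (6 p a x)
    then obtain u where u: "u \<in> ha_lang_state A p" and r': "r' = [] @ [Node a ([] @ [Var x] @ [])] @ u"
      using assms(2) by (auto simp: inst_simps)
    have "tstep (Node a (\<sigma> x)) (subst \<sigma> r')"
      unfolding r' by (rule wrapI[where s = r]) (use assms 6 u r' ha_lang_state_ground in auto)
    then show thesis using single[OF 6(1)] by blast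
  next
    case (7 p a x)
    have "ground r'" using assms(2) 7 by (auto simp: inst_simps ha_lang_state_ground)
    from replI[OF this _ assms(2)] show thesis using single[OF 7(1)] assms(1) 7(1) by simp
  next
    case (8 a x)
    have "ground r'" using assms(2) 8 by (auto simp: inst_simps ha_lang_state_ground)
    from replI[OF this _ assms(2)] show thesis using single[OF 8(1)] assms(1) 8(1) by simp
  next
    case (9 p a x b)
    then obtain u where u: "u \<in> ha_lang_state A p" and r': "r' = [] @ [Node b (u @ [Var x] @ [])] @ []"
      using assms(2) by (auto simp: inst_simps)
    have "tstep (Node a (\<sigma> x)) (subst \<sigma> r')"
      unfolding r' by (rule wrapI[where s = r]) (use assms 9 u r' ha_lang_state_ground in auto)
    then show thesis using single[OF 9(1)] by blast
  next
    case (10 p a x b)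
    then obtain u where u: "u \<in> ha_lang_state A p" and r': "r' = [] @ [Node b ([] @ [Var x] @ u)] @ []"
      using assms(2) by (auto simp: inst_simps)
    have "tstep (Node a (\<sigma> x)) (subst \<sigma> r')"
      unfolding r' by (rule wrapI[where s = r]) (use assms 10 u r' ha_lang_state_ground in auto)
    then show thesis using single[OF 10(1)] by blast
  next
    case (11 ps a x)
    have "ground r'" using assms(2) 11 by (auto simp: inst_simps ha_lang_state_ground dest: inst_hedge_map_State_ground)
    from replI[OF this _ assms(2)] show thesis using single[OF 11(1)] assms(1) 11(1) by simp
  next
    case (12 a x)
    then have "r' = [Var x]" "a \<in> collapses R" using assms by (auto simp: inst_simps collapses_def)
    then show thesis using single[OF 12(1)] tstep.collapse[of a "\<sigma> x"] by (simp add: subst_Cons)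
  qed
qed

lemma rewrite_hstep:
  assumes "rewrite A R h h'" shows "hstep h h'"
  using assms
proof cases
  case (1 l r r' u \<sigma>)
  obtain t where "subst \<sigma> l = [t]" "tstep t (subst \<sigma> r')"
    using rewrite_rule_tstep[OF 1(3,4)] .
  then have "hstep (subst \<sigma> l) (subst \<sigma> r')" by (simp add: hstep_tstep)
  from plug_closed[where Q = hstep, OF 1(5) this hstep_Node hstep_context] show ?thesis
    using 1(1,2) by simp
qed

text \<open>Groundness persists along derivations and lets neighbouring hedges join a rewriting
  context, as the direction from \<open>hsteps\<close> requires.\<close>

lemma rewrites_iff_hsteps:
  assumes "ground h"
  shows "(rewrite A R)\<^sup>*\<^sup>* h h' \<longleftrightarrow> hsteps h h'"
proof
  show "(rewrite A R)\<^sup>*\<^sup>* h h' \<Longrightarrow> hsteps h h'"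
    by (rule rtranclp_mono[THEN predicate2D]) (auto intro: rewrite_hstep)
  assume "hsteps h h'"
  then have "(rewrite A R)\<^sup>*\<^sup>* h h' \<and> ground h'"
    by (induction rule: rtranclp_induct)
      (use assms in \<open>auto intro: hstep_ground hstep_rewrite rtranclp.rtrancl_into_rtrancl\<close>)
  then show "(rewrite A R)\<^sup>*\<^sup>* h h'" by simp
qed

end

section \<open>Residuals of the horizontal languages\<close>

text \<open>The left quotient, or Brzozowski derivative, by a word.\<close>

definition residual :: "'q list set \<Rightarrow> 'q list \<Rightarrow> 'q list set" where
  "residual L w = {v. w @ v \<in> L}"

lemma residual_Nil [simp]: "residual L [] = L"
  by (simp add: residual_def)

lemma residual_residual [simp]: "residual (residual L w) v = residual L (w @ v)"
  by (simp add: residual_def)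

lemma mem_residual: "v \<in> residual L w \<longleftrightarrow> w @ v \<in> L"
  by (simp add: residual_def)

text \<open>A residual is determined by the automaton state reached; a word with a letter outside
  \<open>Q\<close> has the empty residual.\<close>

lemma finite_residuals:
  assumes "regular Q L" shows "finite (range (residual L))"
proof -
  obtain S :: "nat set" and s0 \<delta> F where D: "finite S" "s0 \<in> S"
    "\<forall>s \<in> S. \<forall>q \<in> Q. \<delta> s q \<in> S" "L = {w \<in> lists Q. foldl \<delta> s0 w \<in> F}"
    using assms unfolding regular_def by blast
  have closed: "foldl \<delta> s w \<in> S" if "w \<in> lists Q" "s \<in> S" for s w
    using that D(3) by (induction w arbitrary: s) auto
  have "residual L w \<in> insert {} ((\<lambda>s. {v \<in> lists Q. foldl \<delta> s v \<in> F}) ` S)" for w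
  proof (cases "w \<in> lists Q")
    case True
    then have "residual L w = {v \<in> lists Q. foldl \<delta> (foldl \<delta> s0 w) v \<in> F}"
      by (auto simp: D(4) residual_def)
    then show ?thesis using closed[OF True D(2)] by blast
  next
    case False
    then show ?thesis by (auto simp: D(4) residual_def)
  qed
  then have "range (residual L) \<subseteq> insert {} ((\<lambda>s. {v \<in> lists Q. foldl \<delta> s v \<in> F}) ` S)" by blast
  then show ?thesis using D(1) finite_subset by blast
qed

text \<open>Residuals are the states of one common word automaton for all horizontal languages. A
  term may be read as any state it evaluates to, so its action is a relation.\<close>

definition eval_rel :: "('a, 'q) ha \<Rightarrow> 'q list set set \<Rightarrow> ('a, 'v) tm \<Rightarrow>
    ('q list set \<times> 'q list set) set" where
  "eval_rel A S t = {(X, residual X [q]) | X q. X \<in> S \<and> eval A t q}"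

text \<open>Residuals by successive letters compose to the residual by the word, and the assumption
  keeps the intermediate ones in \<open>S\<close>.\<close>

lemma gap_rel_eval_rel:
  assumes "\<And>X w. X \<in> S \<Longrightarrow> residual X w \<in> S"
  shows "gap_rel S (eval_rel A S) (Id_on S) h =
    {(X, residual X w) | X w. X \<in> S \<and> list_all2 (eval A) h w}"
proof (induction h)
  case Nil
  show ?case by auto
next
  case (Cons t h)
  have "gap_rel S (eval_rel A S) (Id_on S) (t # h) =
      eval_rel A S t O {(X, residual X w) | X w. X \<in> S \<and> list_all2 (eval A) h w}"
    unfolding gap_rel.simps Cons.IH by (auto simp: eval_rel_def)
  also have "\<dots> = {(X, residual X w) | X w. X \<in> S \<and> list_all2 (eval A) (t # h) w}"
  proof (intro equalityI subsetI)
    fix p assume "p \<in> eval_rel A S t O {(X, residual X w) | X w. X \<in> S \<and> list_all2 (eval A) h w}"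
    then obtain X q w where "p = (X, residual X (q # w))" "X \<in> S" "eval A t q" "list_all2 (eval A) h w"
      by (auto simp: eval_rel_def)
    then show "p \<in> {(X, residual X w) | X w. X \<in> S \<and> list_all2 (eval A) (t # h) w}" by auto
  next
    fix p assume "p \<in> {(X, residual X w) | X w. X \<in> S \<and> list_all2 (eval A) (t # h) w}"
    then obtain X q w where *: "p = (X, residual (residual X [q]) w)" "X \<in> S" "eval A t q"
      "list_all2 (eval A) h w"
      by (auto simp: list_all2_Cons1)
    then have "residual X [q] \<in> S" using assms by blast
    then show "p \<in> eval_rel A S t O {(X, residual X w) | X w. X \<in> S \<and> list_all2 (eval A) h w}"
      using * unfolding eval_rel_def by blast
  qed
  finally show ?case .
qed

section \<open>Recognizability of the ground terms in \<open>pre_star\<close>\<close>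

theorem theorem3:
  fixes A :: "('a::finite, 'q) ha"
    and R :: "('a, 'q, 'v) prule set"
    and L :: "('a, 'v) hedge set"
  assumes "infinite (UNIV :: 'v set)"
    and "is_ha A"
    and "is_ptrs A R"
    and "xacu_plus A R"
    and "HA_language L"
  shows "HA_language (pre_star A R L \<inter> ground_terms)"
proof -
  obtain B :: "('a, nat) ha" where B: "is_ha B" "L = ha_lang B"
    using assms(5) unfolding HA_language_def by blast
  interpret xacu_plus_ptrs A R by unfold_locales (rule assms(4))
  \<comment> \<open>Acceptance is treated as one more horizontal language: the word read at top
    level must be a single final state.\<close>
  define F where "F = {[q] | q. q \<in> final B}"
  define LL where "LL = insert F ((\<lambda>(a, K, q). K) ` trans B)"
  define S where "S = (\<Union>K \<in> LL. range (residual K))"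
  have finF: "finite (range (residual F))"
  proof -
    \<comment> \<open>The empty word leaves \<open>F\<close>, a single final state leaves
      \<open>{[]}\<close>, any other word leaves \<open>{}\<close>.\<close>
    have "range (residual F) \<subseteq> {F, {[]}, {}}"
      by (auto simp: F_def residual_def Cons_eq_append_conv append_eq_Cons_conv)
    then show ?thesis by (rule finite_subset) simp
  qed
  have finS: "finite S"
    unfolding S_def LL_def using B(1) finF by (auto simp: is_ha_def intro: finite_residuals)
  have S_closed: "residual X w \<in> S" if "X \<in> S" for X w
  proof -
    obtain K v where "K \<in> LL" "X = residual K v" using \<open>X \<in> S\<close> unfolding S_def by auto
    then have "residual X w \<in> range (residual K)" by simp
    then show ?thesis unfolding S_def using \<open>K \<in> LL\<close> by (rule UN_I[rotated])
  qed
  have LL_S: "K \<in> S" if "K \<in> LL" for K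
    using that residual_Nil unfolding S_def by (metis UN_I rangeI)
  \<comment> \<open>A pair \<open>(K, Y)\<close> of the content with \<open>[] \<in> Y\<close> says
    that it can be read as a word of \<open>K\<close>; the transition then fires, and its target
    \<open>q\<close> acts on every \<open>X\<close> in \<open>S\<close>.\<close>
  define \<Phi> :: "'a \<Rightarrow> ((nat list set \<times> nat list set) \<times> (nat list set \<times> nat list set)) set" where
    "\<Phi> a = {((K, Y), (X, residual X [q])) | K Y X q. (a, K, q) \<in> trans B \<and> [] \<in> Y \<and> X \<in> S}" for a
  have rel: "gap_rel S (eval_rel B S) (Id_on S) h =
      {(X, residual X w) | X w. X \<in> S \<and> list_all2 (eval B) h w}" for h :: "('a, 'v) hedge"
    by (intro gap_rel_eval_rel S_closed)
  interpret observed_hedge_system "wraps A R" "inserts A R" "replacements A R" "collapses R"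
    S "eval_rel B S" \<Phi>
  proof
    show "eval_rel B S t \<subseteq> S \<times> S" for t using S_closed by (auto simp: eval_rel_def)
    show "eval_rel B S (Node a h) = \<Phi> a `` gap_rel S (eval_rel B S) (Id_on S) h"
      for a and h :: "('a, 'v) hedge"
    proof (intro equalityI subsetI)
      fix p assume "p \<in> eval_rel B S (Node a h)"
      then obtain X q K w where *: "p = (X, residual X [q])" "X \<in> S" "(a, K, q) \<in> trans B" "w \<in> K"
        "list_all2 (eval B) h w" by (auto simp: eval_rel_def eval_Node)
      have "K \<in> S" using * by (intro LL_S) (force simp: LL_def)
      then have "(K, residual K w) \<in> gap_rel S (eval_rel B S) (Id_on S) h"
        unfolding rel using * by blast
      moreover have "((K, residual K w), p) \<in> \<Phi> a"
        using * unfolding \<Phi>_def by (auto simp: mem_residual)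
      ultimately show "p \<in> \<Phi> a `` gap_rel S (eval_rel B S) (Id_on S) h" by blast
    next
      fix p assume "p \<in> \<Phi> a `` gap_rel S (eval_rel B S) (Id_on S) h"
      then obtain K w X q where "p = (X, residual X [q])" "X \<in> S" "(a, K, q) \<in> trans B" "w \<in> K"
        "list_all2 (eval B) h w" by (auto simp: \<Phi>_def rel mem_residual)
      then show "p \<in> eval_rel B S (Node a h)" by (auto simp: eval_rel_def eval_Node)
    qed
  qed
  have L_iff: "h \<in> L \<longleftrightarrow> (\<exists>Y. (F, Y) \<in> rel (Id_on S) h \<and> [] \<in> Y)" for h
  proof -
    have "F \<in> S" by (intro LL_S) (simp add: LL_def)
    then have "(\<exists>Y. (F, Y) \<in> rel (Id_on S) h \<and> [] \<in> Y) \<longleftrightarrow> (\<exists>w \<in> F. list_all2 (eval B) h w)"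
      unfolding rel by (auto simp: mem_residual)
    then show ?thesis
      by (auto simp: B(2) ha_lang_def mem_ha_lang_state_iff F_def list_all2_Cons2)
  qed
  \<comment> \<open>Membership in \<open>L\<close> is observed without fillings, so only the
    component for \<open>Id_on S\<close> is inspected: from \<open>F\<close> to a residual
    containing the empty word.\<close>
  define M where "M = {T. \<exists>Y :: nat list set. (Id_on S, (F, Y)) \<in> T \<and> [] \<in> Y}"
  have behaviour_M: "behaviour h \<in> M \<longleftrightarrow> (\<exists>h' \<in> L. hsteps h h')" for h
  proof -
    have "Id_on S \<subseteq> S \<times> S" by auto
    then have "behaviour h \<in> M \<longleftrightarrow> (\<exists>Y. (\<exists>h'. hsteps h h' \<and> (F, Y) \<in> rel (Id_on S) h') \<and> [] \<in> Y)"
      by (simp add: M_def behaviour_def reach_def)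
    also have "\<dots> \<longleftrightarrow> (\<exists>h'. h' \<in> L \<and> hsteps h h')"
      unfolding L_iff by metis
    finally show ?thesis by (simp only: Bex_def)
  qed
  \<comment> \<open>The intersection provides groundness, under which rewriting agrees with
    \<open>hsteps\<close>.\<close>
  have eq: "pre_star A R L \<inter> ground_terms = {h \<in> ground_terms. behaviour h \<in> M}"
  proof (intro set_eqI)
    fix h
    show "h \<in> pre_star A R L \<inter> ground_terms \<longleftrightarrow> h \<in> {h \<in> ground_terms. behaviour h \<in> M}"
    proof (cases "ground h")
      case True
      show ?thesis
        by (simp add: pre_star_def behaviour_M rewrites_iff_hsteps[OF True] conj_commute)
    qed (simp add: ground_terms_def)
  qed
  show ?thesis
    unfolding eq
    by (intro HA_language_congruence finite_range_behaviour finS behaviour_append behaviour_Node)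
qed

end
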